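(* Let $\tau = \frac{4-\sqrt{7}}{9}$, so that $\frac{1+\tau^2}{4} = \frac{26-2\sqrt{7}}{81}$. Let $G_1, G_2, G_3$ be graphs on a common set $V$ of $n$ vertices. If $|E(G_i)| > \frac{1+\tau^2}{4} n^2$ for every $1 \le i \le 3$, then there exists a rainbow triangle, i.e. there exist distinct vertices $v_1, v_2, v_3 \in V$ such that $v_1v_2 \in E(G_1)$, $v_2v_3 \in E(G_2)$ and $v_3v_1 \in E(G_3)$.
   Context: All graphs are finite and simple (undirected, no loops, no multiple edges). The graphs $G_1, G_2, G_3$ share the same vertex set; their edge sets may overlap arbitrarily. *)

theory Defs
  imports Complex_Main
begin

text \<open>A finite simple graph is given by its vertex set and its set of edges, an edge
  being an unordered pair of distinct vertices. In particular, the cardinality of the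
  edge set counts every edge once.\<close>

definition simple_graph :: "'a set \<Rightarrow> 'a set set \<Rightarrow> bool" where
  "simple_graph V E \<longleftrightarrow> finite V \<and> (\<forall>e\<in>E. e \<subseteq> V \<and> card e = 2)"

definition rainbow_triangle ::
    "'a set \<Rightarrow> 'a set set \<Rightarrow> 'a set set \<Rightarrow> 'a set set \<Rightarrow> bool" where
  "rainbow_triangle V E1 E2 E3 \<longleftrightarrow>
     (\<exists>v1\<in>V. \<exists>v2\<in>V. \<exists>v3\<in>V. v1 \<noteq> v2 \<and> v2 \<noteq> v3 \<and> v3 \<noteq> v1 \<and>
        {v1, v2} \<in> E1 \<and> {v2, v3} \<in> E2 \<and> {v3, v1} \<in> E3)"

end

theory Submission
  imports Defs
begin

text \<open>Give every pair xy its set c x y of colours. If there is no rainbow triangle, two adjacent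
  edges carrying different sets of two colours span a pair without colours. First suppose that no
  pair has all three colours, and choose a fractional matching of the pairs with two colours that
  leaves u vertices uncovered. Counting colours between pairs of matching edges shows that there
  are reals x1, x2, x3 of sum at most n such that, over ordered pairs of vertices, the two colours
  other than k are used at most n^2 + (x k)^2 times and all three colours are used at most
  n^2 + x1^2 + x2^2 + x3^2 times; x k is essentially the number of vertices covered by matching
  edges missing colour k, plus a share of the uncovered vertices. Pairs with all three colours are
  removed beforehand along a maximal matching. If every graph has more than (1 + tau^2)/4 n^2
  edges, then x k > tau n for all k, and convexity of the sum of squares, whose maximum is at
  (1 - 2 tau, tau, tau), contradicts 9 tau^2 - 8 tau + 1 = 0.\<close>

section \<open>Matchings\<close>

text \<open>The Halmos-Vaughan induction: a tight proper subset is matched first and its neighbours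
  are withdrawn from the rest; if no nonempty proper subset is tight, any single assignment may be
  made.\<close>

lemma hall_marriage:
  assumes "finite X" "\<And>x. x \<in> X \<Longrightarrow> finite (N x)"
    and "\<And>A. A \<subseteq> X \<Longrightarrow> card A \<le> card (\<Union> (N ` A))"
  shows "\<exists>f. inj_on f X \<and> (\<forall>x\<in>X. f x \<in> N x)"
  using assms
proof (induction "card X" arbitrary: X N rule: less_induct)
  case less
  note fin = \<open>finite X\<close> and finN = less.prems(2) and hall = less.prems(3)
  show ?case
  proof (cases "X = {}")
    case False
    show ?thesis
    proof (cases "\<exists>A. A \<subset> X \<and> A \<noteq> {} \<and> card (\<Union> (N ` A)) \<le> card A")
      case True
      then obtain A where A: "A \<subset> X" "A \<noteq> {}" "card (\<Union> (N ` A)) \<le> card A" by blast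
      have finA: "finite A" using A(1) fin finite_subset by blast
      have "card A < card X" using A(1) fin psubset_card_mono by blast
      then obtain f where f: "inj_on f A" "\<forall>x\<in>A. f x \<in> N x"
        using less.hyps[of A N] finA finN hall A(1) by (meson psubset_imp_subset subsetD subset_trans)
      let ?N = "\<lambda>x. N x - \<Union> (N ` A)"
      have "\<exists>g. inj_on g (X - A) \<and> (\<forall>x\<in>X - A. g x \<in> ?N x)"
      proof (rule less.hyps)
        show "card (X - A) < card X" using A fin
          by (intro psubset_card_mono) auto
        fix B assume B: "B \<subseteq> X - A"
        have finB: "finite B" using B fin finite_subset by blast
        \<comment> \<open>Hall's condition for \<open>B\<close> after the withdrawal is the one for
          \<open>A \<union> B\<close>, reduced by the tight set \<open>A\<close>.\<close>
        have "card A + card B = card (A \<union> B)"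
          using finA finB B by (subst card_Un_disjoint) auto
        also have "\<dots> \<le> card (\<Union> (N ` (A \<union> B)))" using B A(1) by (intro hall) blast
        also have "\<Union> (N ` (A \<union> B)) = \<Union> (N ` A) \<union> \<Union> (?N ` B)" by auto
        also have "card \<dots> \<le> card (\<Union> (N ` A)) + card (\<Union> (?N ` B))" by (rule card_Un_le)
        finally show "card B \<le> card (\<Union> (?N ` B))" using A(3) by linarith
      qed (use fin finN in auto)
      then obtain g where g: "inj_on g (X - A)" "\<forall>x\<in>X - A. g x \<in> ?N x" by blast
      let ?h = "\<lambda>x. if x \<in> A then f x else g x"
      have "inj_on ?h X"
      proof (rule inj_onI)
        fix x y assume xy: "x \<in> X" "y \<in> X" "?h x = ?h y"
        have disj: "f a \<noteq> g b" if "a \<in> A" "b \<in> X - A" for a b using f g that by (metis DiffD2 UN_I)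
        show "x = y"
        proof (cases "x \<in> A")
          case True
          then have "y \<in> A" using xy disj[of x y] by auto
          then show ?thesis using True xy f(1) by (simp add: inj_on_def)
        next
          case False
          then have "y \<notin> A" using xy disj[of y x] by auto
          then show ?thesis using False xy g(1) by (simp add: inj_on_def)
        qed
      qed
      moreover have "\<forall>x\<in>X. ?h x \<in> N x" using f g by auto
      ultimately show ?thesis by blast
    next
      case tight: False
      obtain x where x: "x \<in> X" using False by blast
      have "card {x} \<le> card (N x)" using hall[of "{x}"] x by auto
      then obtain y where y: "y \<in> N x" using card_gt_0_iff by fastforce
      have "\<exists>g. inj_on g (X - {x}) \<and> (\<forall>z\<in>X - {x}. g z \<in> N z - {y})"
      proof (rule less.hyps)
        show "card (X - {x}) < card X" using x fin by (meson card_Diff1_less)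
        fix B assume B: "B \<subseteq> X - {x}"
        have finB: "finite B" using B fin finite_subset by blast
        have eq: "\<Union> ((\<lambda>z. N z - {y}) ` B) = \<Union> (N ` B) - {y}" by auto
        show "card B \<le> card (\<Union> ((\<lambda>z. N z - {y}) ` B))"
        proof (cases "B = {}")
          case False
          \<comment> \<open>Since \<open>B\<close> is not tight, it has a neighbour to spare and may
            lose \<open>y\<close>.\<close>
          have "B \<subset> X" using B x by blast
          then have "card B < card (\<Union> (N ` B))" using tight False by (meson not_le)
          moreover have "card (\<Union> (N ` B)) \<le> Suc (card (\<Union> (N ` B) - {y}))"
            by (cases "y \<in> \<Union> (N ` B)") (use card_Suc_Diff1[of "\<Union> (N ` B)" y] finN B finB in auto)
          ultimately show ?thesis unfolding eq by linarith
        qed simp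
      qed (use fin finN in auto)
      then obtain g where g: "inj_on g (X - {x})" "\<forall>z\<in>X - {x}. g z \<in> N z - {y}" by blast
      have "inj_on (g(x := y)) X"
        using g by (auto simp: inj_on_def)
      moreover have "\<forall>z\<in>X. (g(x := y)) z \<in> N z" using g y by auto
      ultimately show ?thesis by blast
    qed
  qed simp
qed

text \<open>Maximizing the deficiency of an independent set makes Hall's condition hold on both
  remaining parts.\<close>

lemma deficiency_decomposition:
  assumes fin: "finite V" and sym: "\<And>x y. D x y \<Longrightarrow> D y x"
  obtains P T H \<sigma> \<phi> where
    "V = P \<union> T \<union> H" "P \<inter> T = {}" "P \<inter> H = {}" "T \<inter> H = {}"
    "\<And>p y. p \<in> P \<Longrightarrow> y \<in> V \<Longrightarrow> D p y \<Longrightarrow> y \<in> T"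
    "inj_on \<sigma> T" "\<sigma> ` T \<subseteq> P" "\<And>t. t \<in> T \<Longrightarrow> D t (\<sigma> t)"
    "bij_betw \<phi> H H" "\<And>h. h \<in> H \<Longrightarrow> D h (\<phi> h)"
proof -
  define nb where "nb A = {y \<in> V. \<exists>x\<in>A. D x y}" for A
  define indep where "indep A \<longleftrightarrow> A \<subseteq> V \<and> A \<inter> nb A = {}" for A
  define f where "f A = int (card A) - int (card (nb A))" for A
  have finI: "finite {A. indep A}"
    by (rule finite_subset[of _ "Pow V"]) (use fin in \<open>auto simp: indep_def\<close>)
  have "{} \<in> {A. indep A}" by (auto simp: indep_def)
  then have "Max (f ` {A. indep A}) \<in> f ` {A. indep A}"
    using finI by (intro Max_in) auto
  then obtain P where P: "indep P" and Max: "Max (f ` {A. indep A}) = f P" by auto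
  have max: "f A \<le> f P" if "indep A" for A
    unfolding Max[symmetric] using finI that by (intro Max_ge) auto
  define T where "T = nb P"
  define H where "H = V - P - T"
  have PV: "P \<subseteq> V" and TV: "T \<subseteq> V" and PT: "P \<inter> T = {}"
    using P by (auto simp: indep_def T_def nb_def)
  have finP: "finite P" and finT: "finite T" and finH: "finite H"
    using PV TV fin by (auto simp: H_def intro: finite_subset)
  have "\<exists>\<sigma>. inj_on \<sigma> T \<and> (\<forall>t\<in>T. \<sigma> t \<in> {p \<in> P. D t p})"
  proof (rule hall_marriage)
    fix A assume A: "A \<subseteq> T"
    let ?B = "\<Union> ((\<lambda>t. {p \<in> P. D t p}) ` A)"
    have finA: "finite A" using A finT finite_subset by blast
    have B: "?B \<subseteq> P" by auto
    \<comment> \<open>Dropping from \<open>P\<close> all neighbours of \<open>A\<close> takes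
      \<open>A\<close> out of the neighbourhood, so \<open>card ?B < card A\<close> would increase
      \<open>f\<close>.\<close>
    have nbB: "nb (P - ?B) \<subseteq> T - A"
      using A sym by (auto simp: nb_def T_def)
    have "indep (P - ?B)" using P nbB PT by (auto simp: indep_def T_def)
    from max[OF this] have "f (P - ?B) \<le> f P" .
    moreover have "card (nb (P - ?B)) \<le> card T - card A"
      using card_mono[OF _ nbB] finT A finA by (simp add: card_Diff_subset)
    moreover have "card A \<le> card T" "card ?B \<le> card P"
      using A B finT finP by (auto intro: card_mono)
    moreover have "card (P - ?B) = card P - card ?B"
      using finite_subset[OF B finP] B by (rule card_Diff_subset)
    ultimately show "card A \<le> card ?B" unfolding f_def T_def[symmetric] by linarith
  qed (use finT finP in auto)
  then obtain \<sigma> where \<sigma>: "inj_on \<sigma> T" "\<forall>t\<in>T. \<sigma> t \<in> {p \<in> P. D t p}"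
    by (elim exE conjE)
  have "\<exists>\<phi>. inj_on \<phi> H \<and> (\<forall>h\<in>H. \<phi> h \<in> {y \<in> H. D h y})"
  proof (rule hall_marriage)
    fix A assume A: "A \<subseteq> H"
    let ?N = "\<lambda>A. \<Union> ((\<lambda>h. {y \<in> H. D h y}) ` A)"
    \<comment> \<open>The vertices of \<open>A\<close> without a neighbour in \<open>A\<close> can
      join \<open>P\<close>: independence is kept and the neighbourhood gains only their neighbours
      in \<open>H\<close>. By maximality there are at least as many of these.\<close>
    let ?I = "A - ?N A"
    have NI: "?N ?I \<subseteq> ?N A - A"
    proof
      fix y assume "y \<in> ?N ?I"
      then obtain h where h: "h \<in> A" "h \<notin> ?N A" "y \<in> H" "D h y" by auto
      then have "y \<notin> A" using sym[of h y] A by auto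
      then show "y \<in> ?N A - A" using h by auto
    qed
    have nbI: "nb (P \<union> ?I) \<subseteq> T \<union> ?N ?I"
    proof
      fix y assume y: "y \<in> nb (P \<union> ?I)"
      show "y \<in> T \<union> ?N ?I"
      proof (cases "y \<in> T")
        case False
        then obtain x where x: "x \<in> ?I" "D x y" "y \<in> V"
          using y by (auto simp: nb_def T_def)
        have "y \<notin> P" using x A sym by (auto simp: H_def T_def nb_def)
        then show ?thesis using x False by (auto simp: H_def)
      qed simp
    qed
    have "indep (P \<union> ?I)"
      using nbI NI A PV PT unfolding indep_def H_def by blast
    from max[OF this] have "f (P \<union> ?I) \<le> f P" .
    moreover have "card (P \<union> ?I) = card P + card ?I"
      using A finH finP by (intro card_Un_disjoint) (auto simp: H_def intro: finite_subset)
    moreover have "card (nb (P \<union> ?I)) \<le> card T + card (?N ?I)"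
    proof -
      have "finite (?N ?I)" by (rule finite_subset[OF _ finH]) blast
      then have "card (nb (P \<union> ?I)) \<le> card (T \<union> ?N ?I)"
        using nbI finT by (intro card_mono) auto
      then show ?thesis using card_Un_le[of T "?N ?I"] by linarith
    qed
    moreover have "card (?N ?I) + card (A \<inter> ?N A) \<le> card (?N A)"
    proof -
      have fN: "finite (?N A)" by (rule finite_subset[OF _ finH]) blast
      have "finite (?N ?I)" by (rule finite_subset[OF _ finH]) blast
      then have "card (?N ?I) + card (A \<inter> ?N A) = card (?N ?I \<union> (A \<inter> ?N A))"
        using NI fN by (intro card_Un_disjoint[symmetric]) blast+
      also have "\<dots> \<le> card (?N A)" using NI by (intro card_mono[OF fN]) blast
      finally show ?thesis .
    qed
    moreover have "card A = card ?I + card (A \<inter> ?N A)"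
      using A finH by (metis card_Int_Diff finite_subset add.commute)
    ultimately show "card A \<le> card (?N A)" unfolding f_def T_def[symmetric] by linarith
  qed (use finH in auto)
  then obtain \<phi> where \<phi>: "inj_on \<phi> H" "\<forall>h\<in>H. \<phi> h \<in> {y \<in> H. D h y}"
    by (elim exE conjE)
  \<comment> \<open>The cycles of this permutation form a perfect fractional matching of
    \<open>H\<close> by \<open>D\<close>-edges.\<close>
  have "bij_betw \<phi> H H"
    using \<phi> finH by (intro bij_betw_imageI endo_inj_surj) auto
  moreover have "V = P \<union> T \<union> H" "P \<inter> H = {}" "T \<inter> H = {}" using PV TV by (auto simp: H_def)
  moreover have "y \<in> T" if "p \<in> P" "y \<in> V" "D p y" for p y using that by (auto simp: T_def nb_def)
  moreover have "\<sigma> ` T \<subseteq> P" using \<sigma> by auto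
  ultimately show ?thesis using PT \<sigma> \<phi> by (intro that[of P T H \<sigma> \<phi>]) auto
qed

section \<open>Pairs of double edges\<close>

datatype colour = C1 | C2 | C3

lemma UNIV_colour: "UNIV = {C1, C2, C3}"
  using colour.exhaust by auto

instance colour :: finite
  by standard (simp add: UNIV_colour)

lemma card_colour: "card (UNIV :: colour set) = 3"
  by (simp add: UNIV_colour)

lemma card_colour_Compl_set: "card (- A :: colour set) = 3 - card A"
  by (simp add: Compl_eq_Diff_UNIV card_Diff_subset card_colour)

lemma card_colour_Compl: "card (- {k :: colour}) = 2"
  by (simp add: card_colour_Compl_set)

lemma colour_Compl_neq: "- {l :: colour} \<noteq> {k}" "- {l :: colour} \<noteq> {}"
proof -
  have "card (- {l}) \<noteq> card {k}" "card (- {l}) \<noteq> card ({} :: colour set)"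
    by (simp_all add: card_colour_Compl)
  then show "- {l :: colour} \<noteq> {k}" "- {l :: colour} \<noteq> {}" by metis+
qed

lemma card_colour_set_le: "card (A :: colour set) \<le> 3"
  using card_mono[of UNIV A] by (simp add: card_colour)

lemma card_colour_set_eq_2: "card (A :: colour set) = 2 \<longleftrightarrow> (\<exists>k. A = - {k})"
proof
  assume A: "card A = 2"
  then have "card (- A) = 1" by (simp add: card_colour_Compl_set)
  then show "\<exists>k. A = - {k}" by (metis card_1_singletonE double_complement)
qed (auto simp: card_colour_Compl)

lemma card_colour_set_le_2: "(A :: colour set) \<noteq> UNIV \<Longrightarrow> card A \<le> 2"
  using psubset_card_mono[of UNIV A] by (simp add: card_colour psubset_eq)

lemma card_colour_diff_le_2: "card (A - {k :: colour}) \<le> 2"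
  by (rule card_colour_set_le_2) auto

lemma card_colour_diff_le_1:
  assumes "k \<notin> A" "k \<noteq> l" shows "card (A - {l :: colour}) \<le> 1"
proof -
  have "card (A - {l}) \<le> card (- {k, l})" using assms by (intro card_mono) auto
  also have "\<dots> = 1" using assms by (simp add: card_colour_Compl_set)
  finally show ?thesis .
qed

section \<open>Triangles on edges with two or three colours\<close>

locale rainbow_free =
  fixes c :: "'a \<Rightarrow> 'a \<Rightarrow> colour set"
  assumes sym: "c x y = c y x"
    and irrefl: "c x x = {}"
    and free: "\<lbrakk>i \<in> c x y; j \<in> c y z; k \<in> c z x; i \<noteq> j; j \<noteq> k; k \<noteq> i\<rbrakk> \<Longrightarrow> False"
begin

text \<open>An edge with exactly two colours is named by the colour k that it misses.\<close>

lemma double_edge_cases: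
  assumes "c u v = - {k}" "c u w \<noteq> {}" "c v w \<noteq> {}"
  shows "c u w = {k} \<and> c v w = {k} \<or> k \<notin> c u w \<and> k \<notin> c v w"
proof -
  \<comment> \<open>A colour other than \<open>k\<close> on yw, the colour \<open>k\<close> on xw
    and the third colour, available on xy, would form a rainbow triangle.\<close>
  have *: "c y w = {k}" if xy: "c x y = - {k}" and k: "k \<in> c x w" and ne: "c y w \<noteq> {}" for x y
  proof -
    have "i = k" if i: "i \<in> c y w" for i
    proof (rule ccontr)
      assume "i \<noteq> k"
      have "\<exists>j. j \<noteq> i \<and> j \<noteq> k" using \<open>i \<noteq> k\<close>
        by (cases i; cases k) (auto intro: exI[of _ C1] exI[of _ C2] exI[of _ C3])
      then obtain j where "j \<noteq> i" "j \<noteq> k" by blast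
      then show False using free[of j x y i w k] xy k i \<open>i \<noteq> k\<close> sym[of x w] by auto
    qed
    then show ?thesis using ne by blast
  qed
  show ?thesis using *[of u v] *[of v u] assms sym[of u v] by auto
qed

text \<open>Otherwise \<open>c v w\<close> would be \<open>{k}\<close> or avoid \<open>k\<close>,
  but it has two colours and misses only \<open>l\<close>.\<close>

lemma distinct_double_edges:
  assumes "c v u = - {k}" "c v w = - {l}" "k \<noteq> l"
  shows "c u w = {}"
proof (rule ccontr)
  assume "c u w \<noteq> {}"
  moreover have "c v w \<noteq> {}" using assms(2) by (simp add: colour_Compl_neq)
  ultimately have "c v w = {k} \<or> k \<notin> c v w" using double_edge_cases[OF assms(1)] by blast
  moreover have "c v w \<noteq> {k}" using assms(2) by (simp add: colour_Compl_neq)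
  ultimately show False using assms by simp
qed

text \<open>If both pairs to w are coloured, both are \<open>{l}\<close> or both avoid
  \<open>l\<close>; without \<open>k\<close>, at most one colour is left on each. If one pair is
  empty, the other alone has at most two colours besides \<open>k\<close>.\<close>

lemma double_edge_degree:
  assumes "c u v = - {l}" "k \<noteq> l"
  shows "card (c u w - {k}) + card (c v w - {k}) \<le> 2"
proof (cases "c u w = {} \<or> c v w = {}")
  case True
  then show ?thesis using card_colour_diff_le_2 by auto
next
  case False
  then have "card (c u w - {k}) \<le> 1 \<and> card (c v w - {k}) \<le> 1"
    using double_edge_cases[OF assms(1), of w] assms(2) card_colour_diff_le_1[of l _ k]
    by (auto simp: insert_Diff_if)
  then show ?thesis by linarith
qed

text \<open>Different colours on the two other sides would be completed by the third colour on
  uv.\<close>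

lemma full_edge_cases:
  assumes "c u v = UNIV"
  shows "c u w = {} \<or> c v w = {} \<or> (\<exists>i. c u w = {i} \<and> c v w = {i})"
proof -
  have *: "i = j" if ij: "i \<in> c u w" "j \<in> c v w" for i j
  proof (rule ccontr)
    assume "i \<noteq> j"
    then have "\<exists>k. k \<noteq> i \<and> k \<noteq> j"
      by (cases i; cases j) (auto intro: exI[of _ C1] exI[of _ C2] exI[of _ C3])
    then obtain k where "k \<noteq> i" "k \<noteq> j" by blast
    then show False using free[of k u v j w i] assms ij \<open>i \<noteq> j\<close> sym[of u w] by auto
  qed
  then show ?thesis by (metis (no_types, opaque_lifting) equals0I is_singletonI' is_singleton_def singletonD singletonI)
qed

text \<open>These bounds, 3/2 and 1 per end of the edge, are the price of removing both ends. The
  extreme case is an empty pair next to a pair with all colours available.\<close>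

lemma full_edge_degree:
  assumes "c u v = UNIV"
  shows "card (c u w) + card (c v w) \<le> 3"
    and "card (c u w - {k}) + card (c v w - {k}) \<le> 2"
proof -
  show "card (c u w) + card (c v w) \<le> 3"
    using full_edge_cases[OF assms, of w] card_colour_set_le[of "c u w"] card_colour_set_le[of "c v w"]
    by auto
  show "card (c u w - {k}) + card (c v w - {k}) \<le> 2"
    using full_edge_cases[OF assms, of w] card_colour_diff_le_2[of "c u w" k] card_colour_diff_le_2[of "c v w" k]
    by (auto simp: insert_Diff_if)
qed

text \<open>The two edges uv and wz may share vertices; such degenerate quadruples occur in the
  later sums over all ordered pairs.\<close>

definition quad :: "'a \<Rightarrow> 'a \<Rightarrow> 'a \<Rightarrow> 'a \<Rightarrow> nat" where
  "quad u v w z = card (c u w) + card (c u z) + card (c v w) + card (c v z)"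

lemma quad_commute: "quad u v w z = quad v u w z" "quad u v w z = quad u v z w"
    "quad u v w z = quad w z u v"
  using sym[of u w] sym[of u z] sym[of v w] sym[of v z] by (auto simp: quad_def)

end

section \<open>Colours between two double edges\<close>

locale rainbow_free_no_full = rainbow_free +
  assumes not_full: "c x y \<noteq> UNIV"
begin

lemma card_le_2: "card (c x y) \<le> 2"
  by (rule card_colour_set_le_2[OF not_full])

lemma quad_le_8: "quad u v w z \<le> 8"
  using card_le_2[of u w] card_le_2[of u z] card_le_2[of v w] card_le_2[of v z]
  by (simp add: quad_def)

text \<open>With one cross pair empty, five colours require two opposite double edges next to a
  single colour on \<open>c v z\<close>; the triangles over uv and wz then determine which colours
  these double edges miss.\<close>

lemma quad_aux:
  assumes e: "c u v = - {k}" and f: "c w z = - {l}" and "k \<noteq> l" and "c u w = {}"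
  shows "quad u v w z \<le> 4 \<or> quad u v w z = 5 \<and> c v w = - {l} \<and> c u z = - {k}"
proof (cases "c v w = {} \<or> c u z = {} \<or> c v z = {}")
  case True
  then show ?thesis using assms card_le_2[of u z] card_le_2[of v w] card_le_2[of v z]
    by (auto simp: quad_def)
next
  case False
  have 1: "c u z = {k} \<and> c v z = {k} \<or> k \<notin> c u z \<and> k \<notin> c v z"
    using double_edge_cases[OF e] False by blast
  have 2: "c v w = {l} \<and> c v z = {l} \<or> l \<notin> c v w \<and> l \<notin> c v z"
    using double_edge_cases[OF f, of v] False sym by metis
  \<comment> \<open>This pair lies in triangles over both given edges, so it is \<open>{k}\<close>,
    \<open>{l}\<close>, or avoids both colours.\<close>
  have 3: "card (c v z) \<le> 1"
  proof (cases "c v z = {k} \<or> c v z = {l}")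
    case False
    then have "k \<notin> c v z" "c v z - {l} = c v z" using 1 2 by blast+
    then show ?thesis using \<open>k \<noteq> l\<close> card_colour_diff_le_1[of k "c v z" l] by simp
  qed auto
  have 0: "card (c u w) = 0" using assms(4) by simp
  show ?thesis
  proof (cases "card (c v w) = 2 \<and> card (c u z) = 2")
    case True
    then obtain a b where ab: "c v w = - {a}" "c u z = - {b}" using card_colour_set_eq_2 by meson
    moreover have "c v w \<noteq> {l}" "c u z \<noteq> {k}" using True by auto
    ultimately have "l \<notin> - {a}" "k \<notin> - {b}" using 1 2 by metis+
    then have "c v w = - {l}" "c u z = - {k}" using ab by auto
    then show ?thesis using 3 0 True unfolding quad_def by linarith
  next
    case F: False
    then show ?thesis using 3 0 card_le_2[of u z] card_le_2[of v w] unfolding quad_def by linarith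
  qed
qed

text \<open>Between edges missing different colours, five colours instead of the expected four occur
  only along an alternating 4-cycle of double edges.\<close>

lemma quad_distinct_types:
  assumes e: "c u v = - {k}" and f: "c w z = - {l}" and kl: "k \<noteq> l"
  shows "quad u v w z \<le> 5"
    and "quad u v w z > 4 \<Longrightarrow>
      c v w = - {l} \<and> c u z = - {k} \<or> c u w = - {l} \<and> c v z = - {k} \<or>
      c v z = - {l} \<and> c u w = - {k} \<or> c u z = - {l} \<and> c v w = - {k}"
proof -
  have e': "c v u = - {k}" and f': "c z w = - {l}" using e f sym by auto
  \<comment> \<open>Without empty cross pairs the triangle argument applies to each of them and
    leaves one colour on each.\<close>
  have "quad u v w z \<le> 4" if "c u w \<noteq> {}" "c u z \<noteq> {}" "c v w \<noteq> {}" "c v z \<noteq> {}"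
  proof -
    have "card (c x y) \<le> 1" if "x \<in> {u, v}" "y \<in> {w, z}" for x y
    proof -
      have "c x y = {k} \<or> k \<notin> c x y"
        using double_edge_cases[OF e, of y] that \<open>c u w \<noteq> {}\<close> \<open>c u z \<noteq> {}\<close> \<open>c v w \<noteq> {}\<close> \<open>c v z \<noteq> {}\<close> by auto
      moreover have "c x y = {l} \<or> l \<notin> c x y"
        using double_edge_cases[OF f, of x] that \<open>c u w \<noteq> {}\<close> \<open>c u z \<noteq> {}\<close> \<open>c v w \<noteq> {}\<close> \<open>c v z \<noteq> {}\<close>
          sym[of w x] sym[of z x] by auto
      ultimately consider "card (c x y) = 1" | "k \<notin> c x y" "c x y - {l} = c x y" by force
      then show ?thesis using kl card_colour_diff_le_1[of k "c x y" l] by cases auto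
    qed
    from this[of u w] this[of u z] this[of v w] this[of v z] show ?thesis by (simp add: quad_def)
  qed
  then have *: "quad u v w z \<le> 4 \<or> c u w = {} \<or> c u z = {} \<or> c v w = {} \<or> c v z = {}" by blast
  \<comment> \<open>Exchanging the ends of either edge moves any empty cross pair to the position
    uw.\<close>
  have qc: "quad v u w z = quad u v w z" "quad u v z w = quad u v w z" "quad v u z w = quad u v w z"
    using quad_commute by metis+
  show "quad u v w z \<le> 5"
    using * quad_aux[OF e f kl] quad_aux[OF e' f kl] quad_aux[OF e f' kl] quad_aux[OF e' f' kl]
    unfolding qc by linarith
  assume "quad u v w z > 4"
  then have "\<not> quad u v w z \<le> 4" by simp
  then show "c v w = - {l} \<and> c u z = - {k} \<or> c u w = - {l} \<and> c v z = - {k} \<or>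
      c v z = - {l} \<and> c u w = - {k} \<or> c u z = - {l} \<and> c v w = - {k}"
    using * quad_aux[OF e f kl] quad_aux[OF e' f kl] quad_aux[OF e f' kl] quad_aux[OF e' f' kl]
    unfolding qc by blast
qed

text \<open>Each five-colour quadruple joins an end of its edge to an end of wz by an edge missing
  \<open>l\<close>. Either both such edges meet at the same end of wz, or they are attached
  crosswise and two cross pairs are empty.\<close>

lemma common_partner:
  assumes e: "c u v = - {k}" and f: "c u' v' = - {k}" and g: "c w z = - {l}" and kl: "k \<noteq> l"
    and "quad u v w z > 4" "quad u' v' w z > 4"
  shows "quad u v u' v' \<le> 4 \<or> (\<exists>m\<in>{u, v}. \<exists>m'\<in>{u', v'}. \<exists>n. c m n = - {l} \<and> c m' n = - {l})"
proof -
  \<comment> \<open>The crosswise case: x and y each see two double edges of different types, whose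
    far ends therefore span no colour.\<close>
  have opp: "quad m m2 n n2 \<le> 4"
    if "c m x = - {l}" "c m2 y = - {k}" "c n y = - {l}" "c n2 x = - {k}" for m x m2 y n n2
  proof -
    have "c x m = - {l}" "c x n2 = - {k}" "c y m2 = - {k}" "c y n = - {l}"
      using that sym by metis+
    then have "c m n2 = {}" "c m2 n = {}" using distinct_double_edges kl by metis+
    then have "card (c m n2) = 0" "card (c m2 n) = 0" by simp_all
    then show ?thesis using card_le_2[of m n] card_le_2[of m2 n2] unfolding quad_def by linarith
  qed
  define bal where "bal m m2 n n2 \<longleftrightarrow> c m n = - {l} \<and> c m2 n2 = - {k}" for m m2 n n2
  have "bal v u w z \<or> bal u v w z \<or> bal v u z w \<or> bal u v z w"
    using quad_distinct_types(2)[OF e g kl] assms(5) unfolding bal_def by blast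
  then obtain m m2 n n2 where 1: "bal m m2 n n2" "m = u \<and> m2 = v \<or> m = v \<and> m2 = u"
      "n = w \<and> n2 = z \<or> n = z \<and> n2 = w" by metis
  have "bal v' u' w z \<or> bal u' v' w z \<or> bal v' u' z w \<or> bal u' v' z w"
    using quad_distinct_types(2)[OF f g kl] assms(6) unfolding bal_def by blast
  then obtain p p2 q q2 where 2: "bal p p2 q q2" "p = u' \<and> p2 = v' \<or> p = v' \<and> p2 = u'"
      "q = w \<and> q2 = z \<or> q = z \<and> q2 = w" by metis
  show ?thesis
  proof (cases "q = n")
    case True
    then have "c m n = - {l} \<and> c p n = - {l}" using 1(1) 2(1) by (simp add: bal_def)
    moreover have "m \<in> {u, v}" "p \<in> {u', v'}" using 1(2) 2(2) by auto
    ultimately show ?thesis by blast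
  next
    case False
    then have "q = n2" "q2 = n" using 1(3) 2(3) by auto
    then have "quad m m2 p p2 \<le> 4" using 1(1) 2(1) by (intro opp[of m n m2 n2 p p2]) (auto simp: bal_def)
    moreover have "quad m m2 p p2 = quad u v u' v'" using 1(2) 2(2) by (auto simp: quad_def)
    ultimately show ?thesis by simp
  qed
qed

text \<open>The triangle on m, m', n excludes \<open>l\<close> from mm'. If mm' still had two
  colours it would miss exactly \<open>l\<close>, and the edges missing \<open>k\<close> at m and m'
  would make two cross pairs empty.\<close>

lemma common_neighbour:
  assumes e: "c u v = - {k}" and f: "c u' v' = - {k}" and kl: "k \<noteq> l"
    and m: "m \<in> {u, v}" "m' \<in> {u', v'}" and n: "c m n = - {l}" "c m' n = - {l}"
  shows "quad u v u' v' \<le> 4 \<or> card (c m m') \<le> 1 \<and> l \<notin> c m m'"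
proof (cases "c m m' = {}")
  case False
  have "c m' n \<noteq> {l}" "c n m' \<noteq> {}" using n sym[of n m'] by (simp_all add: colour_Compl_neq)
  moreover have "c m m' = {l} \<and> c n m' = {l} \<or> l \<notin> c m m' \<and> l \<notin> c n m'"
    using double_edge_cases[OF n(1) False] \<open>c n m' \<noteq> {}\<close> by blast
  ultimately have l: "l \<notin> c m m'" using sym by metis
  show ?thesis
  proof (cases "card (c m m') \<le> 1")
    case False
    then have "card (c m m') = 2" using card_le_2[of m m'] by linarith
    then have mm: "c m m' = - {l}" using l unfolding card_colour_set_eq_2 by auto
    define p where "p = (if m = u then v else u)"
    define p' where "p' = (if m' = u' then v' else u')"
    have "c m p = - {k}" using m e sym[of u v] by (auto simp: p_def)
    moreover have "c m' p' = - {k}" using m f sym[of u' v'] by (auto simp: p'_def)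
    moreover have "c m' m = - {l}" using mm sym[of m m'] by simp
    ultimately have "c p m' = {}" "c p' m = {}" using distinct_double_edges mm kl by metis+
    then have "card (c p m') = 0" "card (c m p') = 0" using sym[of p' m] by simp_all
    moreover have "quad u v u' v' = quad m p m' p'"
      using m by (auto simp: p_def p'_def quad_def)
    ultimately show ?thesis using card_le_2[of m m'] card_le_2[of p p'] unfolding quad_def by linarith
  qed (use l in simp)
qed simp

text \<open>The excess of quadruples with five colours is paid for by pairs of edges of the same type
  having a common such partner; the deficits caused by partners of two types add up.\<close>

lemma deficit_one:
  assumes "c u v = - {k}" "c u' v' = - {k}" "c w z = - {l}" "k \<noteq> l" "quad u v w z > 4" "quad u' v' w z > 4"
  shows "quad u v u' v' \<le> 7"
proof -
  have "quad u v u' v' \<le> 4 \<or> (\<exists>m\<in>{u, v}. \<exists>m'\<in>{u', v'}. card (c m m') \<le> 1)"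
    using common_partner[OF assms] common_neighbour[OF assms(1,2,4)] by metis
  then consider "quad u v u' v' \<le> 4" | "card (c u u') \<le> 1" | "card (c u v') \<le> 1"
    | "card (c v u') \<le> 1" | "card (c v v') \<le> 1" by auto
  then show ?thesis
    using card_le_2[of u u'] card_le_2[of u v'] card_le_2[of v u'] card_le_2[of v v']
    unfolding quad_def by cases linarith+
qed

text \<open>Each partner yields a cross pair with at most one colour. If these pairs differ, two
  colours are lost. If they coincide, the pair avoids \<open>l\<close> and \<open>l2\<close>, so it
  is empty or \<open>{k}\<close>; in the latter case the adjacent cross pairs also have at most one
  colour.\<close>

lemma deficit_two:
  assumes e: "c u v = - {k}" and f: "c u' v' = - {k}"
    and 1: "c w z = - {l}" "k \<noteq> l" "quad u v w z > 4" "quad u' v' w z > 4"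
    and 2: "c w2 z2 = - {l2}" "k \<noteq> l2" "quad u v w2 z2 > 4" "quad u' v' w2 z2 > 4"
    and "l \<noteq> l2"
  shows "quad u v u' v' \<le> 6"
proof (rule ccontr)
  assume neg: "\<not> quad u v u' v' \<le> 6"
  have neg4: "\<not> quad u v u' v' \<le> 4" using neg by linarith
  obtain m m' where m: "m \<in> {u, v}" "m' \<in> {u', v'}" "card (c m m') \<le> 1" "l \<notin> c m m'"
    using common_partner[OF e f 1] common_neighbour[OF e f 1(2)] neg4 by metis
  obtain p p' where p: "p \<in> {u, v}" "p' \<in> {u', v'}" "card (c p p') \<le> 1" "l2 \<notin> c p p'"
    using common_partner[OF e f 2] common_neighbour[OF e f 2(2)] neg4 by metis
  note le2 = card_le_2[of u u'] card_le_2[of u v'] card_le_2[of v u'] card_le_2[of v v']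
  have uv: "u \<noteq> v" "u' \<noteq> v'" using e f irrefl colour_Compl_neq(2) by metis+
  have same: "m = p \<and> m' = p'"
  proof (rule ccontr)
    assume "\<not> (m = p \<and> m' = p')"
    moreover have "m = u \<or> m = v" "m' = u' \<or> m' = v'" "p = u \<or> p = v" "p' = u' \<or> p' = v'"
      using m p by auto
    ultimately show False using m(3) p(3) neg le2 unfolding quad_def
      by (elim disjE; hypsubst; simp)
  qed
  define q where "q = (if m = u then v else u)"
  define q' where "q' = (if m' = u' then v' else u')"
  have q: "c m q = - {k}" "c m' q' = - {k}"
    using m e f sym[of u v] sym[of u' v'] by (auto simp: q_def q'_def)
  have quad: "quad u v u' v' = quad m q m' q'"
    using m by (auto simp: q_def q'_def quad_def)
  have "c m m' \<noteq> {}"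
  proof
    assume "c m m' = {}"
    then have "card (c m m') = 0" by simp
    then show False
      using neg quad card_le_2[of m q'] card_le_2[of q m'] card_le_2[of q q'] unfolding quad_def by linarith
  qed
  moreover have "c m m' \<subseteq> {k}"
  proof
    fix i assume "i \<in> c m m'"
    then have "i \<noteq> l" "i \<noteq> l2" using m p same by auto
    then show "i \<in> {k}" using 1(2) 2(2) \<open>l \<noteq> l2\<close> by (cases i; cases k; cases l; cases l2; simp)
  qed
  ultimately have k: "c m m' = {k}" by blast
  have "card (c q m') \<le> 1" using double_edge_cases[OF q(1), of m'] k by (cases "c q m' = {}") auto
  moreover have "card (c q' m) \<le> 1"
    using double_edge_cases[OF q(2), of m] k sym[of m' m] by (cases "c q' m = {}") auto
  ultimately show False using neg quad m(3) card_le_2[of q q'] sym[of q' m] unfolding quad_def by simp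
qed

end

section \<open>Counting colours\<close>

text \<open>By AM-GM applied to the ratio of the degrees of the two ends of an edge.\<close>

lemma bipartite_edges_le_common_neighbours:
  assumes fin: "finite X" "finite Y"
  shows "2 * (\<Sum>x\<in>X. \<Sum>y\<in>Y. of_bool (F x y)) \<le>
    (\<Sum>x\<in>X. \<Sum>x'\<in>X. of_bool (\<exists>y\<in>Y. F x y \<and> F x' y)) +
    ((\<Sum>y\<in>Y. \<Sum>y'\<in>Y. of_bool (\<exists>x\<in>X. F x y \<and> F x y')) :: nat)"
proof -
  define dX where "dX x = (\<Sum>y\<in>Y. of_bool (F x y) :: real)" for x
  define dY where "dY y = (\<Sum>x\<in>X. of_bool (F x y) :: real)" for y
  define NX where "NX x = (\<Sum>x'\<in>X. of_bool (\<exists>y\<in>Y. F x y \<and> F x' y) :: real)" for x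
  define NY where "NY y = (\<Sum>y'\<in>Y. of_bool (\<exists>x\<in>X. F x y \<and> F x y') :: real)" for y
  have pos: "dX x > 0" "dY y > 0" if "x \<in> X" "y \<in> Y" "F x y" for x y
    unfolding dX_def dY_def using that fin by (auto simp: card_gt_0_iff)
  \<comment> \<open>All neighbours of y share the neighbour y with x, and symmetrically.\<close>
  have N: "dY y \<le> NX x" "dX x \<le> NY y" if "x \<in> X" "y \<in> Y" "F x y" for x y
    unfolding dX_def dY_def NX_def NY_def using that by (auto intro!: sum_mono)
  have amgm: "2 * of_bool (F x y) \<le> of_bool (F x y) * (dY y / dX x) + of_bool (F x y) * (dX x / dY y)"
    if "x \<in> X" "y \<in> Y" for x y
  proof (cases "F x y")
    case True
    define a b where "a = dX x" and "b = dY y"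
    have "a > 0" "b > 0" using pos[OF that True] by (auto simp: a_def b_def)
    moreover have "2 * (a * b) \<le> b * b + a * a"
      using sum_squares_bound[of a b] by (simp add: power2_eq_square algebra_simps)
    ultimately have "2 \<le> b / a + a / b" by (simp add: field_simps)
    then show ?thesis using True by (simp add: a_def b_def)
  qed simp
  \<comment> \<open>At most \<open>dX x\<close> terms are nonzero, each at most
    \<open>NX x / dX x\<close>.\<close>
  have X: "(\<Sum>y\<in>Y. of_bool (F x y) * (dY y / dX x)) \<le> NX x" if x: "x \<in> X" for x
  proof (cases "dX x = 0")
    case True
    then show ?thesis by (simp add: NX_def sum_nonneg)
  next
    case False
    have "(\<Sum>y\<in>Y. of_bool (F x y) * (dY y / dX x)) \<le> (\<Sum>y\<in>Y. of_bool (F x y) * (NX x / dX x))"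
      using N x by (intro sum_mono) (auto intro!: divide_right_mono simp: dX_def sum_nonneg)
    also have "\<dots> = dX x * (NX x / dX x)" by (simp only: sum_distrib_right[symmetric] dX_def)
    finally show ?thesis using False by simp
  qed
  have Y: "(\<Sum>x\<in>X. of_bool (F x y) * (dX x / dY y)) \<le> NY y" if y: "y \<in> Y" for y
  proof (cases "dY y = 0")
    case True
    then show ?thesis by (simp add: NY_def sum_nonneg)
  next
    case False
    have "(\<Sum>x\<in>X. of_bool (F x y) * (dX x / dY y)) \<le> (\<Sum>x\<in>X. of_bool (F x y) * (NY y / dY y))"
      using N y by (intro sum_mono) (auto intro!: divide_right_mono simp: dY_def sum_nonneg)
    also have "\<dots> = dY y * (NY y / dY y)" by (simp only: sum_distrib_right[symmetric] dY_def)
    finally show ?thesis using False by simp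
  qed
  have "2 * (\<Sum>x\<in>X. \<Sum>y\<in>Y. of_bool (F x y)) = (\<Sum>x\<in>X. \<Sum>y\<in>Y. 2 * (of_bool (F x y) :: real))"
    by (simp add: sum_distrib_left)
  also have "\<dots> \<le> (\<Sum>x\<in>X. \<Sum>y\<in>Y. of_bool (F x y) * (dY y / dX x) + of_bool (F x y) * (dX x / dY y))"
    using amgm by (intro sum_mono)
  also have "\<dots> = (\<Sum>x\<in>X. \<Sum>y\<in>Y. of_bool (F x y) * (dY y / dX x)) +
      (\<Sum>y\<in>Y. \<Sum>x\<in>X. of_bool (F x y) * (dX x / dY y))"
    by (simp only: sum.distrib sum.swap[of _ X Y])
  also have "\<dots> \<le> (\<Sum>x\<in>X. NX x) + (\<Sum>y\<in>Y. NY y)"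
    using X Y by (intro add_mono sum_mono)
  finally have "real (2 * (\<Sum>x\<in>X. \<Sum>y\<in>Y. of_bool (F x y))) \<le> real (
    (\<Sum>x\<in>X. \<Sum>x'\<in>X. of_bool (\<exists>y\<in>Y. F x y \<and> F x' y)) +
    ((\<Sum>y\<in>Y. \<Sum>y'\<in>Y. of_bool (\<exists>x\<in>X. F x y \<and> F x y')) :: nat))"
    by (simp add: NX_def NY_def)
  then show ?thesis by (simp only: of_nat_le_iff)
qed

section \<open>Totals over the vertices covered by a fractional matching\<close>

context rainbow_free
begin

text \<open>The pairs are ordered, so with \<open>A = B\<close> every edge counts twice; colours in
  \<open>K\<close> are ignored.\<close>

definition total :: "colour set \<Rightarrow> 'a set \<Rightarrow> 'a set \<Rightarrow> nat" where
  "total K A B = (\<Sum>x\<in>A. \<Sum>y\<in>B. card (c x y - K))"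

lemma total_commute: "total K A B = total K B A"
  unfolding total_def by (subst sum.swap) (simp add: sym)

lemma total_disjoint_union:
  assumes "finite A" "finite B" "A \<inter> B = {}"
  shows "total K (A \<union> B) (A \<union> B) = total K A A + 2 * total K A B + total K B B"
proof -
  have "total K (A \<union> B) (A \<union> B) = total K A A + total K A B + (total K B A + total K B B)"
    unfolding total_def using assms by (simp add: sum.union_disjoint sum.distrib)
  then show ?thesis using total_commute[of K B A] by simp
qed

text \<open>Averaging over v and its image replaces vertices by edges of the fractional
  matching.\<close>

lemma total_permutation:
  assumes "bij_betw \<phi> J J"
  shows "2 * total K J B = (\<Sum>v\<in>J. \<Sum>y\<in>B. card (c v y - K) + card (c (\<phi> v) y - K))"
proof -
  have "total K J B = (\<Sum>v\<in>J. \<Sum>y\<in>B. card (c (\<phi> v) y - K))"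
    unfolding total_def using sum.reindex_bij_betw[OF assms, of "\<lambda>v. \<Sum>y\<in>B. card (c v y - K)"] by simp
  then show ?thesis by (simp add: total_def sum.distrib)
qed

end

context rainbow_free_no_full
begin

context
  fixes J and \<phi> :: "'a \<Rightarrow> 'a" and \<kappa> :: "'a \<Rightarrow> colour"
  assumes fin: "finite J" and bij: "bij_betw \<phi> J J"
    and type: "\<And>v. v \<in> J \<Longrightarrow> c v (\<phi> v) = - {\<kappa> v}"
begin

lemma sum_same_type:
  "(\<Sum>v\<in>J. \<Sum>w\<in>J. of_bool (\<kappa> v = k \<and> \<kappa> w = k)) = (card {v \<in> J. \<kappa> v = k})\<^sup>2"
proof -
  have "(\<Sum>v\<in>J. \<Sum>w\<in>J. of_bool (\<kappa> v = k \<and> \<kappa> w = k)) =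
      (\<Sum>v\<in>J. \<Sum>w\<in>J. of_bool (\<kappa> v = k) * (of_bool (\<kappa> w = k) :: nat))"
    by (intro sum.cong) auto
  also have "\<dots> = (\<Sum>v\<in>J. of_bool (\<kappa> v = k)) * (\<Sum>w\<in>J. of_bool (\<kappa> w = k))"
    by (simp add: sum_product)
  also have "(\<Sum>v\<in>J. of_bool (\<kappa> v = k)) = card {v \<in> J. \<kappa> v = k}"
    using fin by (simp add: sum_of_bool_eq Int_def)
  finally show ?thesis by (simp add: power2_eq_square)
qed

text \<open>Averaging in both arguments gives sums over four cross pairs. If one of the two edges
  does not miss \<open>k\<close>, \<open>double_edge_degree\<close> bounds such a sum by 4;
  otherwise it is at most 8.\<close>

lemma total_missing_colour_permutation:
  "total {k} J J \<le> (card J)\<^sup>2 + (card {v \<in> J. \<kappa> v = k})\<^sup>2"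
proof -
  let ?d = "\<lambda>x y. card (c x y - {k})"
  have "2 * (2 * total {k} J J) = 2 * (\<Sum>v\<in>J. \<Sum>y\<in>J. ?d v y + ?d (\<phi> v) y)"
    by (simp only: total_permutation[OF bij])
  also have "\<dots> = (\<Sum>v\<in>J. 2 * (\<Sum>y\<in>J. ?d v y + ?d (\<phi> v) y))" by (simp add: sum_distrib_left)
  also have "\<dots> = (\<Sum>v\<in>J. \<Sum>w\<in>J. ?d v w + ?d (\<phi> v) w + (?d v (\<phi> w) + ?d (\<phi> v) (\<phi> w)))"
  proof (rule sum.cong[OF refl])
    fix v
    have "(\<Sum>y\<in>J. ?d v y + ?d (\<phi> v) y) = (\<Sum>w\<in>J. ?d v (\<phi> w) + ?d (\<phi> v) (\<phi> w))"
      using sum.reindex_bij_betw[OF bij, of "\<lambda>y. ?d v y + ?d (\<phi> v) y"] by simp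
    then show "2 * (\<Sum>y\<in>J. ?d v y + ?d (\<phi> v) y) =
        (\<Sum>w\<in>J. ?d v w + ?d (\<phi> v) w + (?d v (\<phi> w) + ?d (\<phi> v) (\<phi> w)))"
      by (simp only: sum.distrib[of "\<lambda>w. ?d v w + ?d (\<phi> v) w"] mult_2)
  qed
  also have "\<dots> \<le> (\<Sum>v\<in>J. \<Sum>w\<in>J. 4 + 4 * of_bool (\<kappa> v = k \<and> \<kappa> w = k))"
  proof (intro sum_mono)
    fix v w assume vw: "v \<in> J" "w \<in> J"
    show "?d v w + ?d (\<phi> v) w + (?d v (\<phi> w) + ?d (\<phi> v) (\<phi> w)) \<le> 4 + 4 * of_bool (\<kappa> v = k \<and> \<kappa> w = k)"
    proof (cases "\<kappa> v = k")
      case True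
      show ?thesis
      proof (cases "\<kappa> w = k")
        case True
        then show ?thesis using \<open>\<kappa> v = k\<close> card_colour_diff_le_2[of "c v w" k] card_colour_diff_le_2[of "c (\<phi> v) w" k]
            card_colour_diff_le_2[of "c v (\<phi> w)" k] card_colour_diff_le_2[of "c (\<phi> v) (\<phi> w)" k] by simp
      next
        case False
        then show ?thesis using double_edge_degree[OF type[OF vw(2)], of k v] double_edge_degree[OF type[OF vw(2)], of k "\<phi> v"]
            sym[of w v] sym[of w "\<phi> v"] sym[of "\<phi> w" v] sym[of "\<phi> w" "\<phi> v"] by simp
      qed
    next
      case False
      then show ?thesis using double_edge_degree[OF type[OF vw(1)], of k w] double_edge_degree[OF type[OF vw(1)], of k "\<phi> w"] by simp
    qed
  qed
  also have "\<dots> = 4 * (card J)\<^sup>2 + 4 * (card {v \<in> J. \<kappa> v = k})\<^sup>2"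
    by (simp add: sum.distrib sum_distrib_left[symmetric] sum_same_type power2_eq_square)
  finally show ?thesis by simp
qed

text \<open>The target is 4 colours per quadruple, plus 4 for equal types. \<open>F\<close> marks
  quadruples of different types exceeding it, \<open>G\<close> pairs of equal type with a common
  partner under \<open>F\<close>; the deficits at \<open>G\<close> pay for \<open>F\<close>.\<close>

lemma total_permutation_le:
  "total {} J J \<le> (card J)\<^sup>2 + (\<Sum>k\<in>UNIV. (card {v \<in> J. \<kappa> v = k})\<^sup>2)"
proof -
  let ?q = "\<lambda>v w. quad v (\<phi> v) w (\<phi> w)"
  define F where "F k l v w \<longleftrightarrow> \<kappa> v = k \<and> \<kappa> w = l \<and> k \<noteq> l \<and> ?q v w > 4" for k l v w
  define G where "G k l v w \<longleftrightarrow> \<kappa> v = k \<and> \<kappa> w = k \<and> k \<noteq> l \<and> (\<exists>g\<in>J. \<kappa> g = l \<and> ?q v g > 4 \<and> ?q w g > 4)" for k l v w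
  define f where "f k l = (\<Sum>v\<in>J. \<Sum>w\<in>J. of_bool (F k l v w) :: nat)" for k l
  define g where "g k l = (\<Sum>v\<in>J. \<Sum>w\<in>J. of_bool (G k l v w) :: nat)" for k l
  \<comment> \<open>\<open>F k l\<close> is a bipartite graph between the edges of types
    \<open>k\<close> and \<open>l\<close>, and \<open>G\<close> is its common neighbour relation on
    either side.\<close>
  have fg: "2 * f k l \<le> g k l + g l k" for k l
  proof -
    have "(\<exists>y\<in>J. F k l x y \<and> F k l x' y) = G k l x x'" for x x' by (auto simp: F_def G_def)
    moreover have "(\<exists>x\<in>J. F k l x y \<and> F k l x y') = G l k y y'" for y y'
      using quad_commute(3) by (auto simp: F_def G_def)
    ultimately show ?thesis
      using bipartite_edges_le_common_neighbours[OF fin fin, of "F k l"] by (simp add: f_def g_def)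
  qed
  have "2 * (\<Sum>k\<in>UNIV. \<Sum>l\<in>UNIV. f k l) = (\<Sum>k\<in>UNIV. \<Sum>l\<in>UNIV. 2 * f k l)"
    by (simp add: sum_distrib_left)
  also have "\<dots> \<le> (\<Sum>k\<in>UNIV. \<Sum>l\<in>UNIV. g k l + g l k)" using fg by (intro sum_mono)
  also have "\<dots> = 2 * (\<Sum>k\<in>UNIV. \<Sum>l\<in>UNIV. g k l)"
    by (simp only: sum.distrib sum.swap[of "\<lambda>k l. g l k"] mult_2)
  finally have fg_sum: "(\<Sum>k\<in>UNIV. \<Sum>l\<in>UNIV. f k l) \<le> (\<Sum>k\<in>UNIV. \<Sum>l\<in>UNIV. g k l)" by simp
  have swap: "(\<Sum>v\<in>J. \<Sum>w\<in>J. \<Sum>k\<in>UNIV. \<Sum>l\<in>UNIV. h k l v w) =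
      (\<Sum>k\<in>UNIV. \<Sum>l\<in>UNIV. \<Sum>v\<in>J. \<Sum>w\<in>J. h k l v w)" for h :: "colour \<Rightarrow> colour \<Rightarrow> 'a \<Rightarrow> 'a \<Rightarrow> nat"
    by (simp add: UNIV_colour sum.distrib)
  have pointwise: "?q v w + (\<Sum>k\<in>UNIV. \<Sum>l\<in>UNIV. of_bool (G k l v w)) \<le>
      4 + 4 * of_bool (\<kappa> v = \<kappa> w) + (\<Sum>k\<in>UNIV. \<Sum>l\<in>UNIV. of_bool (F k l v w))"
    if vw: "v \<in> J" "w \<in> J" for v w
  proof (cases "\<kappa> v = \<kappa> w")
    case False
    have "of_bool (F (\<kappa> v) (\<kappa> w) v w) \<le> (\<Sum>l\<in>UNIV. of_bool (F (\<kappa> v) l v w) :: nat)"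
      by (rule member_le_sum) auto
    also have "\<dots> \<le> (\<Sum>k\<in>UNIV. \<Sum>l\<in>UNIV. of_bool (F k l v w))"
      by (rule member_le_sum[of _ _ "\<lambda>k. \<Sum>l\<in>UNIV. of_bool (F k l v w)"]) auto
    finally have "of_bool (F (\<kappa> v) (\<kappa> w) v w) \<le> (\<Sum>k\<in>UNIV. \<Sum>l\<in>UNIV. of_bool (F k l v w) :: nat)" .
    moreover have "?q v w \<le> 4 + of_bool (F (\<kappa> v) (\<kappa> w) v w)"
      using quad_distinct_types(1)[OF type[OF vw(1)] type[OF vw(2)] False] False by (auto simp: F_def)
    moreover have "G k l v w \<longleftrightarrow> False" for k l using False by (auto simp: G_def)
    ultimately show ?thesis by simp
  next
    case True
    define k where "k = \<kappa> v"
    have kv: "c v (\<phi> v) = - {k}" and kw: "c w (\<phi> w) = - {k}" using type vw True by (auto simp: k_def)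
    have one: "?q v w \<le> 7" if "G k l v w" for l
      using that deficit_one[OF kv kw type] by (auto simp: G_def)
    have two: "?q v w \<le> 6" if "G k l v w" "G k l' v w" "l \<noteq> l'" for l l'
      using that deficit_two[OF kv kw type _ _ _ type] by (auto simp: G_def)
    have "G k' l v w \<longleftrightarrow> False" if "k' \<noteq> k" for k' l using that by (auto simp: G_def k_def)
    then have "(\<Sum>k'\<in>UNIV. \<Sum>l\<in>UNIV. of_bool (G k' l v w) :: nat) = (\<Sum>l\<in>UNIV. of_bool (G k l v w))"
      by (cases k) (simp_all add: UNIV_colour)
    moreover have "(\<Sum>l\<in>UNIV. of_bool (G k l v w)) =
        of_bool (G k C1 v w) + of_bool (G k C2 v w) + (of_bool (G k C3 v w) :: nat)"
      by (simp add: UNIV_colour del: sum_of_bool_eq)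
    \<comment> \<open>So at most two partner types remain, and one or two deficits suffice.\<close>
    moreover have "\<not> G k k v w" by (simp add: G_def)
    then have "?q v w + (of_bool (G k C1 v w) + of_bool (G k C2 v w) + of_bool (G k C3 v w)) \<le> 8"
      using one[of C1] one[of C2] one[of C3] two[of C1 C2] two[of C1 C3] two[of C2 C3]
        quad_le_8[of v "\<phi> v" w "\<phi> w"]
      by (cases k; cases "G k C1 v w"; cases "G k C2 v w"; cases "G k C3 v w") simp_all
    ultimately show ?thesis using True by simp
  qed
  have "4 * total {} J J = (\<Sum>v\<in>J. \<Sum>w\<in>J. ?q v w)"
  proof -
    have "2 * (2 * total {} J J) = 2 * (\<Sum>v\<in>J. \<Sum>y\<in>J. card (c v y) + card (c (\<phi> v) y))"
      using total_permutation[OF bij, of "{}" J] by simp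
    also have "\<dots> = (\<Sum>v\<in>J. 2 * (\<Sum>y\<in>J. card (c v y) + card (c (\<phi> v) y)))" by (simp add: sum_distrib_left)
    also have "\<dots> = (\<Sum>v\<in>J. \<Sum>w\<in>J. ?q v w)"
    proof (rule sum.cong[OF refl])
      fix v
      have "(\<Sum>y\<in>J. card (c v y) + card (c (\<phi> v) y)) = (\<Sum>w\<in>J. card (c v (\<phi> w)) + card (c (\<phi> v) (\<phi> w)))"
        using sum.reindex_bij_betw[OF bij, of "\<lambda>y. card (c v y) + card (c (\<phi> v) y)"] by simp
      then show "2 * (\<Sum>y\<in>J. card (c v y) + card (c (\<phi> v) y)) = (\<Sum>w\<in>J. ?q v w)"
        by (simp add: sum.distrib quad_def)
    qed
    finally show ?thesis by simp
  qed
  moreover have "(\<Sum>v\<in>J. \<Sum>w\<in>J. ?q v w) + (\<Sum>k\<in>UNIV. \<Sum>l\<in>UNIV. g k l) \<le>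
      (\<Sum>v\<in>J. \<Sum>w\<in>J. 4 + 4 * of_bool (\<kappa> v = \<kappa> w)) + (\<Sum>k\<in>UNIV. \<Sum>l\<in>UNIV. f k l)"
    unfolding f_def g_def swap[symmetric] sum.distrib[symmetric]
    using pointwise by (intro sum_mono) simp
  moreover have "(\<Sum>v\<in>J. \<Sum>w\<in>J. 4 + 4 * of_bool (\<kappa> v = \<kappa> w)) =
      4 * (card J)\<^sup>2 + 4 * (\<Sum>k\<in>UNIV. (card {v \<in> J. \<kappa> v = k})\<^sup>2)"
  proof -
    have "(\<Sum>v\<in>J. \<Sum>w\<in>J. of_bool (\<kappa> v = \<kappa> w)) =
        (\<Sum>v\<in>J. \<Sum>w\<in>J. \<Sum>k\<in>UNIV. of_bool (\<kappa> v = k \<and> \<kappa> w = k) :: nat)"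
    proof (intro sum.cong refl)
      fix v w show "of_bool (\<kappa> v = \<kappa> w) = (\<Sum>k\<in>UNIV. of_bool (\<kappa> v = k \<and> \<kappa> w = k) :: nat)"
        by (cases "\<kappa> v"; cases "\<kappa> w") (simp_all add: UNIV_colour)
    qed
    also have "\<dots> = (\<Sum>k\<in>UNIV. \<Sum>v\<in>J. \<Sum>w\<in>J. of_bool (\<kappa> v = k \<and> \<kappa> w = k))"
      by (simp add: UNIV_colour sum.distrib del: sum_of_bool_eq)
    finally show ?thesis
      by (simp add: sum.distrib sum_distrib_left[symmetric] sum_same_type power2_eq_square)
  qed
  ultimately show ?thesis using fg_sum by linarith
qed

end

end

text \<open>The tangent bound \<open>a + e / a\<close>, weakened by \<open>2 * t \<le> a\<close>.
  For \<open>t = 0\<close> the quotient is 0 by convention, which is right because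
  \<open>e = 0\<close>.\<close>

lemma sqrt_sum_le:
  assumes "0 \<le> e" "2 * t \<le> a" "t = 0 \<longrightarrow> e = 0" "0 \<le> (t :: real)"
  shows "sqrt (a\<^sup>2 + 2 * e) \<le> a + e / (2 * t)"
proof (cases "t = 0")
  case False
  then have t: "t > 0" using assms by simp
  have "e \<le> a * (e / (2 * t))"
  proof -
    have "e = (2 * t) * (e / (2 * t))" using t by simp
    also have "\<dots> \<le> a * (e / (2 * t))" using assms t by (intro mult_right_mono) auto
    finally show ?thesis .
  qed
  then have "a\<^sup>2 + 2 * e \<le> (a + e / (2 * t))\<^sup>2"
    by (simp only: power2_sum mult.assoc) (use zero_le_power2[of "e / (2 * t)"] in linarith)
  then show ?thesis using assms t by (intro real_le_lsqrt) auto
qed (use assms in auto)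

section \<open>Vertices left uncovered by the matching\<close>

context rainbow_free_no_full
begin

text \<open>Three colours require a double edge tw and a coloured pair pw; by
  \<open>distinct_double_edges\<close> tw then misses the same colour as tp.\<close>

lemma double_edge_outside_degree:
  assumes tp: "c t p = - {l}" and pw: "card (c p w) \<le> 1"
  shows "card (c t w) + card (c p w) \<le> 2 + of_bool (c w t = - {l} \<and> c w p \<noteq> {})"
proof (cases "c p w = {} \<or> card (c t w) \<le> 1")
  case True
  then show ?thesis using pw card_le_2[of t w] by (elim disjE) auto
next
  case False
  then have "card (c t w) = 2" using card_le_2[of t w] by linarith
  then obtain k where k: "c t w = - {k}" by (auto simp: card_colour_set_eq_2)
  then have "k = l" using distinct_double_edges[OF tp k] False by blast
  then show ?thesis using False k pw card_le_2[of t w] sym[of w t] sym[of w p] by simp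
qed

text \<open>The colours of the edges matching T into P are kept fixed. Among the matchings with these
  colours, one minimizing the total of m (the least relative degree into a colour class of T)
  over the uncovered vertices works: at a bad uncovered vertex w, some matched partner v is
  joined to w by a single colour, which makes two neighbourhoods disjoint and forces m v < m w,
  so that exchanging v and w would lower the total.\<close>

lemma balanced_matching:
  fixes \<kappa> :: "'a \<Rightarrow> colour"
  assumes fin: "finite P" "finite T" and PT: "P \<inter> T = {}"
    and indep: "\<And>p q. p \<in> P \<Longrightarrow> q \<in> P \<Longrightarrow> card (c p q) \<le> 1"
    and \<sigma>0: "inj_on \<sigma>0 T" "\<sigma>0 ` T \<subseteq> P" "\<And>t. t \<in> T \<Longrightarrow> c t (\<sigma>0 t) = - {\<kappa> t}"
  shows "\<exists>\<sigma>. inj_on \<sigma> T \<and> \<sigma> ` T \<subseteq> P \<and> (\<forall>t\<in>T. c t (\<sigma> t) = - {\<kappa> t}) \<and>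
    (\<forall>w\<in>P - \<sigma> ` T.
      (\<Sum>k\<in>UNIV. card {t \<in> T. \<kappa> t = k \<and> c w t = - {k} \<and> c w (\<sigma> t) \<noteq> {}} /
        card {t \<in> T. \<kappa> t = k}) \<le> (2 :: real))"
proof -
  define ok where "ok \<sigma> \<longleftrightarrow> inj_on \<sigma> T \<and> \<sigma> ` T \<subseteq> P \<and> (\<forall>t\<in>T. c t (\<sigma> t) = - {\<kappa> t})" for \<sigma>
  define N where "N k p = {t \<in> T. \<kappa> t = k \<and> c p t = - {k}}" for k p
  define T' where "T' k = {t \<in> T. \<kappa> t = k}" for k
  define \<xi> where "\<xi> k p = (card (N k p) / card (T' k) :: real)" for k p
  define m where "m p = Min (range (\<lambda>k. \<xi> k p))" for p
  have m_le: "m p \<le> \<xi> k p" for p k unfolding m_def by (rule Min_le) auto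
  have m_ex: "\<exists>k. m p = \<xi> k p" for p
  proof -
    have "m p \<in> range (\<lambda>k. \<xi> k p)" unfolding m_def by (rule Min_in) auto
    then show ?thesis by auto
  qed
  have finT: "finite (T' k)" "finite (N k p)" for k p using fin by (auto simp: T'_def N_def)
  have NT: "N k p \<subseteq> T' k" for k p by (auto simp: N_def T'_def)
  define S where "S = {P - \<sigma> ` T | \<sigma>. ok \<sigma>}"
  define g where "g U = (\<Sum>w\<in>U. m w)" for U
  have "finite S" by (rule finite_subset[of _ "Pow P"]) (use fin in \<open>auto simp: S_def\<close>)
  moreover have "ok \<sigma>0" using \<sigma>0 by (simp add: ok_def)
  then have "S \<noteq> {}" by (auto simp: S_def)
  ultimately have "Min (g ` S) \<in> g ` S" and Min: "\<And>U. U \<in> S \<Longrightarrow> Min (g ` S) \<le> g U" by auto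
  then obtain \<sigma> where ok: "ok \<sigma>" and gMin: "Min (g ` S) = g (P - \<sigma> ` T)"
    by (auto simp: S_def)
  define U where "U = P - \<sigma> ` T"
  define ex where "ex k w = {t \<in> T. \<kappa> t = k \<and> c w t = - {k} \<and> c w (\<sigma> t) \<noteq> {}}" for k w
  have "(\<Sum>k\<in>UNIV. card (ex k w) / card (T' k)) \<le> (2 :: real)" if w: "w \<in> U" for w
  proof (rule ccontr)
    assume neg: "\<not> (\<Sum>k\<in>UNIV. card (ex k w) / card (T' k)) \<le> (2 :: real)"
    have exN: "card (ex k w) / card (T' k) \<le> \<xi> k w" for k
      unfolding \<xi>_def using finT by (intro divide_right_mono) (auto intro!: card_mono simp: ex_def N_def)
    have N1: "\<xi> k p \<le> 1" for k p
      unfolding \<xi>_def using card_mono[OF finT(1) NT] by (auto simp: divide_le_eq)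
    obtain k0 where k0: "m w = \<xi> k0 w" using m_ex by blast
    \<comment> \<open>Three ratios of at most 1 with sum above 2 are all positive.\<close>
    have "ex k0 w \<noteq> {}"
    proof
      assume "ex k0 w = {}"
      define r where "r k = card (ex k w) / card (T' k)" for k
      have "r k0 = 0" using \<open>ex k0 w = {}\<close> by (simp add: r_def)
      moreover have "r k \<le> 1" for k using exN[of k] N1[of k w] by (simp add: r_def)
      from this[of C1] this[of C2] this[of C3]
      have "r C1 \<le> 1" "r C2 \<le> 1" "r C3 \<le> 1" .
      ultimately show False using neg unfolding r_def[symmetric]
        by (cases k0) (simp_all add: UNIV_colour)
    qed
    then obtain t where t: "t \<in> T" "\<kappa> t = k0" "c w t = - {k0}" "c w (\<sigma> t) \<noteq> {}" by (auto simp: ex_def)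
    define v where "v = \<sigma> t"
    have v: "v \<in> P" "c t v = - {k0}" using ok t by (auto simp: ok_def v_def)
    have wP: "w \<in> P" "w \<notin> \<sigma> ` T" using w by (auto simp: U_def)
    have "card (c w v) \<le> 1" "c w v \<noteq> {}" using indep wP v t by (auto simp: v_def)
    then obtain i where i: "c w v = {i}"
      by (metis card_1_singletonE card_eq_0_iff finite_code le_less less_one)
    have "i \<noteq> k0"
      using double_edge_cases[OF t(3), of v] i v(2) colour_Compl_neq by auto
    \<comment> \<open>A common neighbour along edges missing \<open>i\<close> would exclude the
      colour \<open>i\<close> from wv.\<close>
    have "N i w \<inter> N i v = {}"
    proof (rule ccontr)
      assume "N i w \<inter> N i v \<noteq> {}"
      then obtain t' where "c w t' = - {i}" "c t' v = - {i}" using sym by (auto simp: N_def)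
      then show False using double_edge_cases[of w t' i v] i colour_Compl_neq by auto
    qed
    then have "card (N i w) + card (N i v) = card (N i w \<union> N i v)"
      using finT by (simp add: card_Un_disjoint)
    also have "\<dots> \<le> card (T' i)" using NT finT by (intro card_mono) auto
    finally have "\<xi> i w + \<xi> i v \<le> 1"
      unfolding \<xi>_def add_divide_distrib[symmetric] by (auto simp: divide_le_eq)
    moreover have "(\<Sum>k\<in>UNIV. card (ex k w) / card (T' k)) \<le> (\<Sum>k\<in>UNIV. \<xi> k w)"
      using exN by (intro sum_mono)
    then have "(\<Sum>k\<in>UNIV. \<xi> k w) > 2" using neg by linarith
    \<comment> \<open>The remaining third ratio is at most 1. Hence \<open>\<xi> i v\<close> is
      below \<open>\<xi> k0 w\<close>, the minimum at w.\<close>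
    then have "\<xi> i w > 1 - \<xi> k0 w"
      using \<open>i \<noteq> k0\<close> N1[of C1 w] N1[of C2 w] N1[of C3 w] by (cases i; cases k0) (auto simp: UNIV_colour)
    ultimately have mv: "m v < m w" using m_le[of v i] k0 by linarith
    define \<sigma>' where "\<sigma>' = \<sigma>(t := w)"
    have inj: "inj_on \<sigma> T" using ok by (simp add: ok_def)
    have "inj_on \<sigma>' T" using inj wP(2) by (auto simp: \<sigma>'_def inj_on_def)
    \<comment> \<open>The edge tw misses the same colour as tv, so all types are preserved.\<close>
    then have "ok \<sigma>'" using ok t wP sym[of w t] by (auto simp: ok_def \<sigma>'_def)
    then have "P - \<sigma>' ` T \<in> S" by (auto simp: S_def)
    moreover have "P - \<sigma>' ` T = insert v (U - {w})"
    proof -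
      have "\<sigma>' ` T = insert w (\<sigma> ` T - {v})"
        using t(1) inj by (auto simp: \<sigma>'_def v_def inj_on_def)
      moreover have "v \<in> \<sigma> ` T" using t(1) by (auto simp: v_def)
      ultimately show ?thesis using wP v by (auto simp: U_def)
    qed
    ultimately have "g U \<le> g (insert v (U - {w}))" using Min gMin by (metis U_def)
    also have "\<dots> = m v + g (U - {w})"
      unfolding g_def using fin t(1) by (subst sum.insert) (auto simp: U_def v_def)
    also have "\<dots> < m w + g (U - {w})" using mv by simp
    also have "\<dots> = g U" unfolding g_def using fin w by (subst sum.remove[of U w]) (auto simp: U_def)
    finally show False by simp
  qed
  then show ?thesis using ok unfolding ok_def U_def ex_def T'_def by blast
qed

text \<open>\<open>J\<close> is covered by the fractional matching and \<open>U\<close> is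
  uncovered. With \<open>a k\<close> covered vertices of type \<open>k\<close> and
  \<open>E k\<close> excess colours of that type towards \<open>U\<close>, the numbers
  \<open>x k\<close> are chosen so that their squares are
  \<open>(a k)\<^sup>2 + 2 * E k\<close>.\<close>

lemma no_full_totals:
  assumes fin: "finite V"
  obtains x :: "colour \<Rightarrow> real" where "\<And>k. 0 \<le> x k" "(\<Sum>k\<in>UNIV. x k) \<le> card V"
    "total {} V V \<le> (card V)\<^sup>2 + (\<Sum>k\<in>UNIV. (x k)\<^sup>2)"
    "\<And>k. total {k} V V \<le> (card V)\<^sup>2 + (x k)\<^sup>2"
proof -
  define D where "D x y \<longleftrightarrow> card (c x y) = 2" for x y
  have "D y x" if "D x y" for x y using that sym by (simp add: D_def)
  then obtain P T H \<sigma>0 \<phi> where V: "V = P \<union> T \<union> H"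
    and disj: "P \<inter> T = {}" "P \<inter> H = {}" "T \<inter> H = {}"
    and nbP: "\<And>p y. p \<in> P \<Longrightarrow> y \<in> V \<Longrightarrow> D p y \<Longrightarrow> y \<in> T"
    and \<sigma>0: "inj_on \<sigma>0 T" "\<sigma>0 ` T \<subseteq> P" "\<And>t. t \<in> T \<Longrightarrow> D t (\<sigma>0 t)"
    and \<phi>: "bij_betw \<phi> H H" "\<And>h. h \<in> H \<Longrightarrow> D h (\<phi> h)"
    using deficiency_decomposition[OF fin, of D] by metis
  have finP: "finite P" "finite T" "finite H" using fin V by auto
  \<comment> \<open>Double edges at \<open>P\<close> lead only to \<open>T\<close>.\<close>
  have single: "card (c p y) \<le> 1" if "p \<in> P" "y \<in> P \<union> H" for p y
    using nbP[of p y] that disj V card_le_2[of p y] by (force simp: D_def)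
  then have indep: "card (c p q) \<le> 1" if "p \<in> P" "q \<in> P" for p q using that by blast
  have "\<exists>k. c t (\<sigma>0 t) = - {k}" if "t \<in> T" for t
    using \<sigma>0(3)[OF that] by (simp add: D_def card_colour_set_eq_2)
  then obtain \<kappa> where \<kappa>: "\<And>t. t \<in> T \<Longrightarrow> c t (\<sigma>0 t) = - {\<kappa> t}" by metis
  have "\<exists>k. c h (\<phi> h) = - {k}" if "h \<in> H" for h
    using \<phi>(2)[OF that] by (simp add: D_def card_colour_set_eq_2)
  then obtain \<kappa>H where \<kappa>H: "\<And>h. h \<in> H \<Longrightarrow> c h (\<phi> h) = - {\<kappa>H h}" by metis
  have "\<exists>\<sigma>. inj_on \<sigma> T \<and> \<sigma> ` T \<subseteq> P \<and> (\<forall>t\<in>T. c t (\<sigma> t) = - {\<kappa> t}) \<and>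
    (\<forall>w\<in>P - \<sigma> ` T.
      (\<Sum>k\<in>UNIV. card {t \<in> T. \<kappa> t = k \<and> c w t = - {k} \<and> c w (\<sigma> t) \<noteq> {}} /
        card {t \<in> T. \<kappa> t = k}) \<le> (2 :: real))"
    by (rule balanced_matching)
      (fact finP(1) finP(2) disj(1) indep \<sigma>0(1) \<sigma>0(2) \<kappa>)+
  then obtain \<sigma> where \<sigma>: "inj_on \<sigma> T" "\<sigma> ` T \<subseteq> P" "\<And>t. t \<in> T \<Longrightarrow> c t (\<sigma> t) = - {\<kappa> t}"
    and bal: "\<And>w. w \<in> P - \<sigma> ` T \<Longrightarrow>
      (\<Sum>k\<in>UNIV. card {t \<in> T. \<kappa> t = k \<and> c w t = - {k} \<and> c w (\<sigma> t) \<noteq> {}} /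
        card {t \<in> T. \<kappa> t = k}) \<le> (2 :: real)"
    by (elim exE conjE) (rule that, auto)
  define U where "U = P - \<sigma> ` T"
  define J where "J = T \<union> \<sigma> ` T \<union> H"
  define \<tau> where "\<tau> = the_inv_into T \<sigma>"
  have \<tau>: "\<tau> (\<sigma> t) = t" if "t \<in> T" for t using the_inv_into_f_f[OF \<sigma>(1) that] by (simp add: \<tau>_def)
  define \<Phi> where "\<Phi> v = (if v \<in> T then \<sigma> v else if v \<in> H then \<phi> v else \<tau> v)" for v
  define \<kappa>J where "\<kappa>J v = (if v \<in> T then \<kappa> v else if v \<in> H then \<kappa>H v else \<kappa> (\<tau> v))" for v
  have \<sigma>out: "\<sigma> t \<notin> T" "\<sigma> t \<notin> H" if "t \<in> T" for t using \<sigma>(2) that disj by auto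
  have \<Phi>\<sigma>: "\<Phi> (\<sigma> t) = t" "\<kappa>J (\<sigma> t) = \<kappa> t" if "t \<in> T" for t
    using \<sigma>out that \<tau> by (auto simp: \<Phi>_def \<kappa>J_def)
  have \<Phi>T: "\<Phi> t = \<sigma> t" "\<kappa>J t = \<kappa> t" if "t \<in> T" for t using that by (auto simp: \<Phi>_def \<kappa>J_def)
  have \<Phi>H: "\<Phi> h = \<phi> h" "\<kappa>J h = \<kappa>H h" if "h \<in> H" for h using that disj by (auto simp: \<Phi>_def \<kappa>J_def)
  have finJ: "finite J" "finite U" using finP by (auto simp: J_def U_def)
  have VJU: "V = J \<union> U" "J \<inter> U = {}" using V disj \<sigma>(2) by (auto simp: J_def U_def)
  have bij: "bij_betw \<Phi> J J"
  proof -
    have "\<Phi> ` J = \<Phi> ` T \<union> \<Phi> ` \<sigma> ` T \<union> \<Phi> ` H" by (auto simp: J_def)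
    also have "\<Phi> ` T = \<sigma> ` T" using \<Phi>T by auto
    also have "\<Phi> ` \<sigma> ` T = T" using \<Phi>\<sigma> by (force simp: image_image)
    also have "\<Phi> ` H = H" using \<Phi>H \<phi>(1) by (auto simp: bij_betw_def)
    finally have "\<Phi> ` J = J" by (auto simp: J_def)
    then show ?thesis using finJ(1) by (metis bij_betw_def eq_card_imp_inj_on)
  qed
  have type: "c v (\<Phi> v) = - {\<kappa>J v}" if v: "v \<in> J" for v
  proof -
    consider "v \<in> T" | t where "t \<in> T" "v = \<sigma> t" | "v \<in> H"
      using v by (auto simp: J_def)
    then show ?thesis
    proof cases
      case 2
      then show ?thesis using \<Phi>\<sigma> \<sigma>(3) sym[of t "\<sigma> t"] by simp
    qed (use \<Phi>T \<Phi>H \<sigma>(3) \<kappa>H in auto)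
  qed
  define T' where "T' k = {t \<in> T. \<kappa> t = k}" for k
  define ex where "ex k w = {t \<in> T. \<kappa> t = k \<and> c w t = - {k} \<and> c w (\<sigma> t) \<noteq> {}}" for k w
  define E where "E k = (\<Sum>w\<in>U. card (ex k w))" for k
  define a where "a k = card {v \<in> J. \<kappa>J v = k}" for k
  have finT': "finite (T' k)" "finite (ex k w)" for k w using finP by (auto simp: T'_def ex_def)
  have a_ge: "2 * card (T' k) \<le> a k" for k
  proof -
    have "card (T' k \<union> \<sigma> ` T' k) = card (T' k) + card (\<sigma> ` T' k)"
      using finT' \<sigma>out by (intro card_Un_disjoint) (auto simp: T'_def)
    also have "card (\<sigma> ` T' k) = card (T' k)"
      using \<sigma>(1) by (intro card_image) (auto simp: T'_def inj_on_def)
    finally have "2 * card (T' k) = card (T' k \<union> \<sigma> ` T' k)" by simp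
    also have "\<dots> \<le> a k" unfolding a_def
      using finJ \<Phi>T \<Phi>\<sigma> by (intro card_mono) (auto simp: T'_def J_def)
    finally show ?thesis .
  qed
  have sum_a: "(\<Sum>k\<in>UNIV. a k) = card J"
  proof -
    have "card J = card (\<Union>k\<in>UNIV. {v \<in> J. \<kappa>J v = k})" by (rule arg_cong[of _ _ card]) auto
    also have "\<dots> = (\<Sum>k\<in>UNIV. a k)" unfolding a_def
      using finJ by (intro card_UN_disjoint) auto
    finally show ?thesis by simp
  qed
  have cardV: "card V = card J + card U" using VJU finJ by (simp add: card_Un_disjoint)
  have cardJ: "card J = 2 * card T + card H"
  proof -
    have "card J = card (T \<union> \<sigma> ` T) + card H" unfolding J_def
      using finP disj \<sigma>out by (intro card_Un_disjoint) auto
    also have "card (T \<union> \<sigma> ` T) = card T + card (\<sigma> ` T)"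
      using finP \<sigma>out by (intro card_Un_disjoint) auto
    finally show ?thesis using card_image[OF \<sigma>(1)] by simp
  qed
  have diff_le: "card (A - K) \<le> card A" for A K :: "colour set" by (rule card_mono) auto
  have UU: "total K U U \<le> (card U)\<^sup>2" for K
  proof -
    have "total K U U \<le> (\<Sum>x\<in>U. \<Sum>y\<in>U. 1)" unfolding total_def
      using single order_trans[OF diff_le] by (intro sum_mono) (auto simp: U_def)
    then show ?thesis by (simp add: power2_eq_square)
  qed
  \<comment> \<open>An edge from t to its partner sends two colours to w, up to the excess
    \<open>e t w\<close>; a vertex of \<open>H\<close> sends at most one. Both amount to one colour
    per covered vertex.\<close>
  have JU: "total K J U \<le> card J * card U + (\<Sum>t\<in>T. \<Sum>w\<in>U. e t w)"
    if e: "\<And>t w. t \<in> T \<Longrightarrow> w \<in> U \<Longrightarrow> card (c t w - K) + card (c (\<sigma> t) w - K) \<le> 2 + e t w" for K e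
  proof -
    have "total K J U = total K T U + total K (\<sigma> ` T) U + total K H U"
      unfolding total_def J_def using finP disj \<sigma>out
      by (subst sum.union_disjoint; (subst sum.union_disjoint)?; auto)
    also have "total K (\<sigma> ` T) U = (\<Sum>t\<in>T. \<Sum>w\<in>U. card (c (\<sigma> t) w - K))"
      unfolding total_def using \<sigma>(1) by (simp add: sum.reindex)
    also have "total K T U + \<dots> = (\<Sum>t\<in>T. \<Sum>w\<in>U. card (c t w - K) + card (c (\<sigma> t) w - K))"
      by (simp add: total_def sum.distrib)
    also have "\<dots> \<le> (\<Sum>t\<in>T. \<Sum>w\<in>U. 2 + e t w)" using e by (intro sum_mono)
    also have "\<dots> = 2 * card T * card U + (\<Sum>t\<in>T. \<Sum>w\<in>U. e t w)"
      by (simp add: sum.distrib del: add_2_eq_Suc)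
    finally have "total K J U \<le> 2 * card T * card U + (\<Sum>t\<in>T. \<Sum>w\<in>U. e t w) + total K H U" by simp
    moreover have "total K H U \<le> (\<Sum>h\<in>H. \<Sum>w\<in>U. 1)" unfolding total_def
      using single sym order_trans[OF diff_le] by (intro sum_mono) (metis DiffD1 UnCI U_def)
    ultimately show ?thesis by (simp add: cardJ algebra_simps)
  qed
  have ex_sum: "(\<Sum>t\<in>T. \<Sum>w\<in>U. of_bool (\<kappa> t = k \<and> t \<in> ex (\<kappa> t) w)) = E k" for k
  proof -
    have "(\<Sum>t\<in>T. of_bool (\<kappa> t = k \<and> t \<in> ex (\<kappa> t) w)) = card (ex k w)" for w
    proof -
      have "T \<inter> {t. \<kappa> t = k \<and> t \<in> ex (\<kappa> t) w} = ex k w" by (auto simp: ex_def)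
      then show ?thesis using finP by simp
    qed
    then show ?thesis unfolding E_def by (subst sum.swap) simp
  qed
  have tw: "card (c t w) + card (c (\<sigma> t) w) \<le> 2 + of_bool (t \<in> ex (\<kappa> t) w)"
    if "t \<in> T" "w \<in> U" for t w
  proof -
    have "card (c (\<sigma> t) w) \<le> 1" using that \<sigma>(2) by (intro single) (auto simp: U_def)
    moreover have "t \<in> ex (\<kappa> t) w \<longleftrightarrow> c w t = - {\<kappa> t} \<and> c w (\<sigma> t) \<noteq> {}"
      using that by (simp add: ex_def)
    ultimately show ?thesis
      using double_edge_outside_degree[OF \<sigma>(3)[OF that(1)], of w] by simp
  qed
  have JU0: "total {} J U \<le> card J * card U + (\<Sum>k\<in>UNIV. E k)"
  proof -
    have "(\<Sum>t\<in>T. \<Sum>w\<in>U. of_bool (t \<in> ex (\<kappa> t) w)) =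
        (\<Sum>t\<in>T. \<Sum>w\<in>U. \<Sum>k\<in>UNIV. of_bool (\<kappa> t = k \<and> t \<in> ex (\<kappa> t) w) :: nat)"
    proof (intro sum.cong refl)
      fix t w show "of_bool (t \<in> ex (\<kappa> t) w) = (\<Sum>k\<in>UNIV. of_bool (\<kappa> t = k \<and> t \<in> ex (\<kappa> t) w) :: nat)"
        by (cases "\<kappa> t") (simp_all add: UNIV_colour del: sum_of_bool_eq)
    qed
    also have "\<dots> = (\<Sum>k\<in>UNIV. E k)"
      by (simp add: UNIV_colour sum.distrib ex_sum del: sum_of_bool_eq)
    finally show ?thesis using JU[of "{}" "\<lambda>t w. of_bool (t \<in> ex (\<kappa> t) w)"] tw by simp
  qed
  have JUk: "total {k} J U \<le> card J * card U + E k" for k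
  proof -
    have "card (c t w - {k}) + card (c (\<sigma> t) w - {k}) \<le> 2 + of_bool (\<kappa> t = k \<and> t \<in> ex (\<kappa> t) w)"
      if "t \<in> T" "w \<in> U" for t w
    proof (cases "\<kappa> t = k")
      case True
      then show ?thesis using tw[OF that] diff_le[of "c t w" "{k}"] diff_le[of "c (\<sigma> t) w" "{k}"] by simp
    next
      case False
      then show ?thesis using double_edge_degree[OF \<sigma>(3)[OF that(1)], of k w] by simp
    qed
    from JU[OF this] show ?thesis using ex_sum by simp
  qed
  define x where "x k = sqrt ((real (a k))\<^sup>2 + 2 * real (E k))" for k
  have x2: "(x k)\<^sup>2 = (real (a k))\<^sup>2 + 2 * real (E k)" for k by (simp add: x_def)
  have "0 \<le> x k" for k by (simp add: x_def)
  moreover have "(\<Sum>k\<in>UNIV. x k) \<le> card V"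
  proof -
    have "x k \<le> a k + E k / (2 * real (card (T' k)))" for k
      unfolding x_def
    proof (rule sqrt_sum_le)
      show "2 * real (card (T' k)) \<le> a k" using a_ge[of k] by linarith
      show "real (card (T' k)) = 0 \<longrightarrow> real (E k) = 0"
      proof
        assume "real (card (T' k)) = 0"
        then have "T' k = {}" using finT' by simp
        then have "ex k w = {}" for w by (auto simp: T'_def ex_def)
        then show "real (E k) = 0" by (simp add: E_def)
      qed
    qed auto
    then have "(\<Sum>k\<in>UNIV. x k) \<le> (\<Sum>k\<in>UNIV. a k + E k / (2 * real (card (T' k))))" by (intro sum_mono)
    also have "\<dots> = card J + (\<Sum>k\<in>UNIV. E k / (2 * real (card (T' k))))"
      using sum_a by (simp add: sum.distrib flip: of_nat_sum)
    also have "(\<Sum>k\<in>UNIV. E k / (2 * real (card (T' k)))) =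
        (\<Sum>k\<in>UNIV. \<Sum>w\<in>U. (card (ex k w) / card (T' k)) / 2)"
      by (simp add: E_def sum_divide_distrib mult.commute)
    also have "\<dots> = (\<Sum>w\<in>U. (\<Sum>k\<in>UNIV. card (ex k w) / card (T' k)) / 2)"
      by (subst sum.swap) (simp add: sum_divide_distrib)
    \<comment> \<open>The balance condition bounds each inner sum by 2, so an uncovered vertex adds
      at most 1 to the sum of the \<open>x k\<close>.\<close>
    also have "\<dots> \<le> (\<Sum>w\<in>U. 1)"
      using bal unfolding U_def ex_def T'_def by (intro sum_mono) simp
    finally show ?thesis using cardV by simp
  qed
  moreover have "total {} V V \<le> (card V)\<^sup>2 + (\<Sum>k\<in>UNIV. (x k)\<^sup>2)"
  proof -
    have "total {} V V = total {} J J + 2 * total {} J U + total {} U U"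
      unfolding VJU(1) by (rule total_disjoint_union[OF finJ VJU(2)])
    also have "\<dots> \<le> (card V)\<^sup>2 + ((\<Sum>k\<in>UNIV. (a k)\<^sup>2) + 2 * (\<Sum>k\<in>UNIV. E k))"
      using total_permutation_le[OF finJ(1) bij type] JU0 UU[of "{}"]
      unfolding cardV a_def[symmetric] power2_sum by simp
    also have "(\<Sum>k\<in>UNIV. (a k)\<^sup>2) + 2 * (\<Sum>k\<in>UNIV. E k) = (\<Sum>k\<in>UNIV. (a k)\<^sup>2 + 2 * E k)"
      by (simp add: sum.distrib sum_distrib_left)
    finally have "real (total {} V V) \<le> real ((card V)\<^sup>2 + (\<Sum>k\<in>UNIV. (a k)\<^sup>2 + 2 * E k))"
      by (simp only: of_nat_le_iff)
    then show ?thesis by (simp add: x2)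
  qed
  moreover have "total {k} V V \<le> (card V)\<^sup>2 + (x k)\<^sup>2" for k
  proof -
    have "total {k} V V = total {k} J J + 2 * total {k} J U + total {k} U U"
      unfolding VJU(1) by (rule total_disjoint_union[OF finJ VJU(2)])
    also have "\<dots> \<le> (card V)\<^sup>2 + ((a k)\<^sup>2 + 2 * E k)"
      using total_missing_colour_permutation[OF finJ(1) bij type, of k] JUk[of k] UU[of "{k}"]
      unfolding cardV a_def[symmetric] power2_sum by simp
    finally have "real (total {k} V V) \<le> real ((card V)\<^sup>2 + ((a k)\<^sup>2 + 2 * E k))"
      by (simp only: of_nat_le_iff)
    then show ?thesis by (simp add: x2)
  qed
  ultimately show ?thesis using that[of x] by blast
qed

end

section \<open>Removing edges with three colours\<close>

context rainbow_free
begin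

lemma total_union_left:
  assumes "finite A" "finite B" "A \<inter> B = {}"
  shows "total K (A \<union> B) C = total K A C + total K B C"
  unfolding total_def using assms by (rule sum.union_disjoint)

text \<open>Full edges are removed greedily with both ends. The bounds hold for every
  \<open>B\<close> because they come from single vertices w, so they serve inside \<open>Q\<close>
  as well as towards the rest.\<close>

lemma maximal_full_matching:
  assumes "finite V"
  shows "\<exists>Q\<subseteq>V. (\<forall>x\<in>V - Q. \<forall>y\<in>V - Q. c x y \<noteq> UNIV) \<and>
    (\<forall>B. 2 * total {} Q B \<le> 3 * card Q * card B \<and> (\<forall>k. total {k} Q B \<le> card Q * card B))"
  using assms
proof (induction V rule: finite_psubset_induct)
  case (psubset V)
  show ?case
  proof (cases "\<exists>u\<in>V. \<exists>v\<in>V. c u v = UNIV")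
    case False
    then show ?thesis by (intro exI[of _ "{}"]) (simp add: total_def)
  next
    case True
    then obtain u v where uv: "u \<in> V" "v \<in> V" "c u v = UNIV" by blast
    have "u \<noteq> v" using uv irrefl by auto
    have "V - {u, v} \<subset> V" using uv by auto
    from psubset.IH[OF this] obtain Q where Q: "Q \<subseteq> V - {u, v}"
      and max: "\<forall>x\<in>V - {u, v} - Q. \<forall>y\<in>V - {u, v} - Q. c x y \<noteq> UNIV"
      and "\<forall>B. 2 * total {} Q B \<le> 3 * card Q * card B \<and> (\<forall>k. total {k} Q B \<le> card Q * card B)"
      by (elim exE conjE) (rule that)
    then have tot: "2 * total {} Q B \<le> 3 * card Q * card B" "total {k} Q B \<le> card Q * card B" for B k
      by simp_all
    have finQ: "finite Q" using Q psubset.hyps finite_subset by blast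
    have disj: "{u, v} \<inter> Q = {}" using Q by auto
    have card: "card ({u, v} \<union> Q) = 2 + card Q"
      using disj finQ \<open>u \<noteq> v\<close> by (subst card_Un_disjoint) auto
    have pair: "total K {u, v} B = (\<Sum>w\<in>B. card (c u w - K) + card (c v w - K))" for K B
      using \<open>u \<noteq> v\<close> by (simp add: total_def sum.distrib)
    have union: "total K ({u, v} \<union> Q) B = total K {u, v} B + total K Q B" for K B
      using disj finQ by (intro total_union_left) auto
    have "2 * total {} ({u, v} \<union> Q) B \<le> 3 * card ({u, v} \<union> Q) * card B" for B
    proof -
      have "total {} {u, v} B \<le> (\<Sum>w\<in>B. 3)"
        unfolding pair using full_edge_degree(1)[OF uv(3)] by (intro sum_mono) simp
      then show ?thesis using tot(1)[of B] unfolding union card by (simp add: algebra_simps)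
    qed
    moreover have "total {k} ({u, v} \<union> Q) B \<le> card ({u, v} \<union> Q) * card B" for k B
    proof -
      have "total {k} {u, v} B \<le> (\<Sum>w\<in>B. 2)"
        unfolding pair using full_edge_degree(2)[OF uv(3)] by (intro sum_mono)
      then show ?thesis using tot(2)[of k B] unfolding union card by (simp add: algebra_simps)
    qed
    moreover have "{u, v} \<union> Q \<subseteq> V" using Q uv by auto
    moreover have "\<forall>x\<in>V - ({u, v} \<union> Q). \<forall>y\<in>V - ({u, v} \<union> Q). c x y \<noteq> UNIV" using max by blast
    ultimately show ?thesis by blast
  qed
qed

text \<open>Here q counts the removed vertices. Their density 3/2 exceeds 1 by the terms in q; with
  one colour ignored the density is at most 1 and no such terms arise.\<close>

lemma totals_bound:
  assumes fin: "finite V"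
  shows "\<exists>q r (x :: colour \<Rightarrow> real). q + r = card V \<and> (\<forall>k. 0 \<le> x k) \<and> (\<Sum>k\<in>UNIV. x k) \<le> real r \<and>
    total {} V V \<le> (card V)\<^sup>2 + (real q)\<^sup>2 / 2 + real q * real r + (\<Sum>k\<in>UNIV. (x k)\<^sup>2) \<and>
    (\<forall>k. total {k} V V \<le> (card V)\<^sup>2 + (x k)\<^sup>2)"
proof -
  obtain Q where Q: "Q \<subseteq> V" and max: "\<forall>x\<in>V - Q. \<forall>y\<in>V - Q. c x y \<noteq> UNIV"
    and "\<forall>B. 2 * total {} Q B \<le> 3 * card Q * card B \<and> (\<forall>k. total {k} Q B \<le> card Q * card B)"
    using maximal_full_matching[OF fin] by (elim exE conjE) (rule that)
  then have tot: "2 * total {} Q B \<le> 3 * card Q * card B" "total {k} Q B \<le> card Q * card B" for B k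
    by simp_all
  define W where "W = V - Q"
  \<comment> \<open>Erasing all pairs outside \<open>W\<close> makes the locale condition hold on
    the whole type.\<close>
  define c' where "c' x y = (if x \<in> W \<and> y \<in> W then c x y else {})" for x y
  interpret N: rainbow_free_no_full c'
  proof
    show "c' x y = c' y x" for x y using sym by (simp add: c'_def)
    show "c' x x = {}" for x by (simp add: c'_def irrefl)
    show False if "i \<in> c' x y" "j \<in> c' y z" "k \<in> c' z x" "i \<noteq> j" "j \<noteq> k" "k \<noteq> i" for i j k x y z
      using that free[of i x y j z k] by (auto simp: c'_def split: if_splits)
    show "c' x y \<noteq> UNIV" for x y using max by (auto simp: c'_def W_def)
  qed
  have N: "N.total K W W = total K W W" for K
    unfolding N.total_def total_def by (intro sum.cong refl) (simp add: c'_def)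
  have finQW: "finite Q" "finite W" "Q \<inter> W = {}" and V: "V = Q \<union> W"
    using fin Q finite_subset by (auto simp: W_def)
  obtain x :: "colour \<Rightarrow> real" where x: "\<And>k. 0 \<le> x k" "(\<Sum>k\<in>UNIV. x k) \<le> card W"
    and tW: "total {} W W \<le> (card W)\<^sup>2 + (\<Sum>k\<in>UNIV. (x k)\<^sup>2)"
      "\<And>k. total {k} W W \<le> (card W)\<^sup>2 + (x k)\<^sup>2"
    using N.no_full_totals[OF finQW(2)] unfolding N by blast
  have card: "card V = card Q + card W" using V finQW card_Un_disjoint by blast
  have split: "total K V V = total K Q Q + 2 * total K Q W + total K W W" for K
    unfolding V by (rule total_disjoint_union[OF finQW])
  have "real (2 * total {} Q Q) \<le> real (3 * card Q * card Q)"
    "real (2 * total {} Q W) \<le> real (3 * card Q * card W)"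
    using tot(1) by (simp_all only: of_nat_le_iff)
  then have "total {} V V \<le> (card V)\<^sup>2 + (real (card Q))\<^sup>2 / 2 + real (card Q) * real (card W) + (\<Sum>k\<in>UNIV. (x k)\<^sup>2)"
    using tW(1) unfolding split card by (simp add: power2_eq_square algebra_simps)
  moreover have "total {k} V V \<le> (card V)\<^sup>2 + (x k)\<^sup>2" for k
  proof -
    have "real (total {k} Q Q) \<le> real (card Q * card Q)"
      "real (total {k} Q W) \<le> real (card Q * card W)"
      using tot(2) by (simp_all only: of_nat_le_iff)
    then show ?thesis using tW(2)[of k] unfolding split card by (simp add: power2_eq_square algebra_simps)
  qed
  ultimately show ?thesis
    using x card by (intro exI[of _ "card Q"] exI[of _ "card W"] exI[of _ x]) simp
qed

end

section \<open>The theorem\<close>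

text \<open>The quadratic in tau says that 1 - 4 tau + 6 tau^2 = (1 + 3 tau^2) / 2, the value of the
  sum of squares at (1 - 2 tau, tau, tau).\<close>

lemma extremal_inequality:
  fixes \<tau> n q r a b d :: real
  assumes "9 * \<tau>\<^sup>2 - 8 * \<tau> + 1 = 0" "0 < \<tau>" "\<tau> \<le> 1 / 5" "0 < n" "0 \<le> q" "q + r = n"
    and abd: "\<tau> * n < a" "\<tau> * n < b" "\<tau> * n < d" "a + b + d \<le> r"
  shows "q\<^sup>2 / 2 + q * r + (a\<^sup>2 + b\<^sup>2 + d\<^sup>2) \<le> (1 + 3 * \<tau>\<^sup>2) / 2 * n\<^sup>2"
proof -
  define t where "t = \<tau> * n"
  have t: "9 * t\<^sup>2 - 8 * t * n + n\<^sup>2 = 0"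
  proof -
    have "9 * t\<^sup>2 - 8 * t * n + n\<^sup>2 = (9 * \<tau>\<^sup>2 - 8 * \<tau> + 1) * n\<^sup>2"
      by (simp add: t_def power2_eq_square algebra_simps)
    then show ?thesis using assms(1) by simp
  qed
  have tn: "0 < t" "5 * t \<le> n" using assms by (simp_all add: t_def)
  \<comment> \<open>The square lies below its chord on the interval from t to r - 2t, which contains
    a, b and d since each exceeds t.\<close>
  have *: "y\<^sup>2 \<le> (r - t) * y - t * (r - 2 * t)" if "t < y" "y \<le> r - 2 * t" for y
  proof -
    have "(y - t) * (r - 2 * t - y) \<ge> 0" using that by simp
    then show ?thesis by (simp add: power2_eq_square algebra_simps)
  qed
  have "a\<^sup>2 + b\<^sup>2 + d\<^sup>2 \<le> (r - t) * (a + b + d) - 3 * t * (r - 2 * t)"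
    using *[of a] *[of b] *[of d] abd unfolding t_def[symmetric] by (simp add: algebra_simps)
  also have "\<dots> \<le> (r - t) * r - 3 * t * (r - 2 * t)"
    using abd tn unfolding t_def[symmetric] by (intro diff_right_mono mult_left_mono) auto
  finally have "a\<^sup>2 + b\<^sup>2 + d\<^sup>2 \<le> (r - t) * r - 3 * t * (r - 2 * t)" .
  \<comment> \<open>After substituting r = n - q, this is exactly what makes q = 0 the worst case;
    it follows from q < n - 3t and 5t \<le> n.\<close>
  moreover have "q * q \<le> q * (2 * n - 8 * t)"
    using assms(5,6) abd tn unfolding t_def[symmetric] by (intro mult_left_mono) auto
  moreover have r: "r = n - q" using assms by simp
  moreover have rhs: "(1 + 3 * \<tau>\<^sup>2) / 2 * n\<^sup>2 = n\<^sup>2 - 4 * t * n + 6 * t\<^sup>2"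
  proof -
    have "(1 + 3 * \<tau>\<^sup>2) / 2 * n\<^sup>2 = (n\<^sup>2 + 3 * t\<^sup>2) / 2"
      by (simp add: t_def power2_eq_square field_simps)
    moreover have "9 * t\<^sup>2 - 8 * (t * n) + n\<^sup>2 = 0" using t by (simp add: mult.assoc)
    ultimately show ?thesis by (simp add: mult.assoc)
  qed
  ultimately show ?thesis unfolding rhs r by (simp add: power2_eq_square algebra_simps)
qed

lemma card_ordered_edges:
  assumes "simple_graph V E"
  shows "(\<Sum>x\<in>V. \<Sum>y\<in>V. of_bool ({x, y} \<in> E)) = 2 * card E"
proof -
  have fin: "finite V" and E: "\<And>e. e \<in> E \<Longrightarrow> e \<subseteq> V \<and> card e = 2"
    using assms by (auto simp: simple_graph_def)
  have finE: "finite E" by (rule finite_subset[of _ "Pow V"]) (use fin E in auto)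
  define P where "P e = {(x, y). {x, y} = e}" for e :: "'a set"
  have P: "finite (P e) \<and> card (P e) = 2" if e: "e \<in> E" for e
  proof -
    obtain a b where ab: "e = {a, b}" "a \<noteq> b" using E[OF e] by (meson card_2_iff)
    then have "P e = {(a, b), (b, a)}" by (auto simp: P_def doubleton_eq_iff)
    then show ?thesis using ab by simp
  qed
  have "(\<Sum>x\<in>V. \<Sum>y\<in>V. of_bool ({x, y} \<in> E)) = (\<Sum>(x, y)\<in>V \<times> V. of_bool ({x, y} \<in> E))"
    by (simp only: sum.cartesian_product)
  also have "\<dots> = card {z \<in> V \<times> V. case z of (x, y) \<Rightarrow> {x, y} \<in> E}"
    using fin by (simp add: case_prod_unfold Int_def)
  also have "{z \<in> V \<times> V. case z of (x, y) \<Rightarrow> {x, y} \<in> E} = (\<Union>e\<in>E. P e)"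
    using E by (auto simp: P_def)
  also have "card \<dots> = (\<Sum>e\<in>E. card (P e))"
    using finE P by (intro card_UN_disjoint) (auto simp: P_def)
  also have "\<dots> = 2 * card E" using P by simp
  finally show ?thesis by simp
qed

theorem theorem1p2:
  fixes \<tau> :: real
  assumes "\<tau> = (4 - sqrt 7) / 9"
  shows "(1 + \<tau>\<^sup>2) / 4 = (26 - 2 * sqrt 7) / 81 \<and>
    (\<forall>(V :: 'a set) E1 E2 E3 n.
       simple_graph V E1 \<and> simple_graph V E2 \<and> simple_graph V E3 \<and> card V = n \<and>
       real (card E1) > (1 + \<tau>\<^sup>2) / 4 * (real n)\<^sup>2 \<and>
       real (card E2) > (1 + \<tau>\<^sup>2) / 4 * (real n)\<^sup>2 \<and>
       real (card E3) > (1 + \<tau>\<^sup>2) / 4 * (real n)\<^sup>2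
       \<longrightarrow> rainbow_triangle V E1 E2 E3)"
proof (intro conjI allI impI)
  have \<tau>2: "81 * \<tau>\<^sup>2 = 23 - 8 * sqrt 7"
  proof -
    have "9 * \<tau> = 4 - sqrt 7" by (simp add: assms)
    then have "(9 * \<tau>)\<^sup>2 = (4 - sqrt 7)\<^sup>2" by (simp only:)
    then show ?thesis by (simp add: power2_diff power_mult_distrib)
  qed
  then show "(1 + \<tau>\<^sup>2) / 4 = (26 - 2 * sqrt 7) / 81" by simp
  have \<tau>: "9 * \<tau>\<^sup>2 - 8 * \<tau> + 1 = 0" 
  proof -
    have "9 * \<tau> = 4 - sqrt 7" by (simp add: assms)
    then show ?thesis using \<tau>2 by linarith
  qed
  have "sqrt 7 < 4" by (rule real_less_lsqrt) simp_all
  \<comment> \<open>The value 11/5 corresponds to \<open>\<tau> = 1 / 5\<close>.\<close>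
  moreover have "11 / 5 < sqrt 7" by (rule real_less_rsqrt) (simp add: power2_eq_square)
  ultimately have \<tau>_bounds: "0 < \<tau>" "\<tau> \<le> 1 / 5" by (simp_all add: assms)
  fix V :: "'a set" and E1 E2 E3 n
  assume *: "simple_graph V E1 \<and> simple_graph V E2 \<and> simple_graph V E3 \<and> card V = n \<and>
       real (card E1) > (1 + \<tau>\<^sup>2) / 4 * (real n)\<^sup>2 \<and>
       real (card E2) > (1 + \<tau>\<^sup>2) / 4 * (real n)\<^sup>2 \<and>
       real (card E3) > (1 + \<tau>\<^sup>2) / 4 * (real n)\<^sup>2"
  define E where "E i = (case i of C1 \<Rightarrow> E1 | C2 \<Rightarrow> E2 | C3 \<Rightarrow> E3)" for i
  have graph: "simple_graph V (E i)" and large: "real (card (E i)) > (1 + \<tau>\<^sup>2) / 4 * (real n)\<^sup>2" for i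
    using * by (cases i; simp add: E_def)+
  have n: "card V = n" and fin: "finite V" using * by (auto simp: simple_graph_def)
  show "rainbow_triangle V E1 E2 E3"
  proof (rule ccontr)
    assume no: "\<not> rainbow_triangle V E1 E2 E3"
    have edge: "x \<noteq> y \<and> x \<in> V \<and> y \<in> V" if "{x, y} \<in> E i" for x y i
    proof -
      have "{x, y} \<subseteq> V" "card {x, y} = 2" using graph[of i] that by (auto simp: simple_graph_def)
      then show ?thesis by (auto simp: card_insert_if split: if_splits)
    qed
    have no': "\<not> ({x, y} \<in> E C1 \<and> {y, z} \<in> E C2 \<and> {z, x} \<in> E C3)" for x y z
    proof
      assume a: "{x, y} \<in> E C1 \<and> {y, z} \<in> E C2 \<and> {z, x} \<in> E C3"
      then have "x \<noteq> y \<and> y \<noteq> z \<and> z \<noteq> x \<and> x \<in> V \<and> y \<in> V \<and> z \<in> V" using edge by metis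
      then have "rainbow_triangle V E1 E2 E3" using a unfolding rainbow_triangle_def E_def by auto
      then show False using no by simp
    qed
    define c where "c x y = {i. {x, y} \<in> E i}" for x y
    interpret rainbow_free c
    proof
      show "c x y = c y x" for x y by (simp add: c_def insert_commute)
      show "c x x = {}" for x using edge[of x x] by (auto simp: c_def)
      show False if "i \<in> c x y" "j \<in> c y z" "k \<in> c z x" "i \<noteq> j" "j \<noteq> k" "k \<noteq> i" for i j k x y z
        \<comment> \<open>The six orders of the colours correspond to six orders of the
          vertices.\<close>
        using that no'[of x y z] no'[of y z x] no'[of z x y] no'[of y x z] no'[of x z y] no'[of z y x]
        by (cases i; cases j; cases k) (simp_all add: c_def insert_commute)
    qed
    have total: "total K V V = (\<Sum>i\<in>- K. 2 * card (E i))" for K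
    proof -
      have "card (c x y - K) = (\<Sum>i\<in>- K. of_bool ({x, y} \<in> E i))" for x y
        by (simp add: c_def Diff_eq Int_commute)
      then have "total K V V = (\<Sum>x\<in>V. \<Sum>y\<in>V. \<Sum>i\<in>- K. of_bool ({x, y} \<in> E i))"
        by (simp only: total_def)
      also have "\<dots> = (\<Sum>i\<in>- K. \<Sum>x\<in>V. \<Sum>y\<in>V. of_bool ({x, y} \<in> E i))"
        by (simp only: sum.swap[of _ "- K"])
      also have "\<dots> = (\<Sum>i\<in>- K. 2 * card (E i))" by (simp only: card_ordered_edges[OF graph])
      finally show ?thesis .
    qed
    obtain q r and x :: "colour \<Rightarrow> real" where qr: "q + r = n" and x: "\<And>k. 0 \<le> x k" "(\<Sum>k\<in>UNIV. x k) \<le> real r"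
      and tot: "total {} V V \<le> (real n)\<^sup>2 + (real q)\<^sup>2 / 2 + real q * real r + (\<Sum>k\<in>UNIV. (x k)\<^sup>2)"
        "\<And>k. total {k} V V \<le> (real n)\<^sup>2 + (x k)\<^sup>2"
      using totals_bound[OF fin] unfolding n by auto
    \<comment> \<open>On no vertices there are no edges, contradicting the strict bound.\<close>
    have "n > 0"
    proof (rule ccontr)
      assume "\<not> n > 0"
      then have "V = {}" using n fin by simp
      then have "total {} V V = 0" by (simp add: total_def)
      then have "card (E C1) = 0" by (simp add: total UNIV_colour)
      then show False using large[of C1] \<open>\<not> n > 0\<close> by simp
    qed
    have gt: "\<tau> * n < x k" for k
    proof -
      \<comment> \<open>Two graphs remain, each edge being counted twice.\<close>
      have "(1 + \<tau>\<^sup>2) * (real n)\<^sup>2 < total {k} V V"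
        using large[of C1] large[of C2] large[of C3] unfolding total Compl_eq_Diff_UNIV UNIV_colour
        by (cases k) (simp_all add: insert_Diff_if field_simps)
      also have "\<dots> \<le> (real n)\<^sup>2 + (x k)\<^sup>2" using tot(2) .
      finally have "(\<tau> * n)\<^sup>2 < (x k)\<^sup>2" by (simp add: power_mult_distrib algebra_simps)
      then show ?thesis using x(1) by (rule power_less_imp_less_base)
    qed
    have "real q + real r = real n" using qr by linarith
    then have "(real q)\<^sup>2 / 2 + real q * real r + ((x C1)\<^sup>2 + (x C2)\<^sup>2 + (x C3)\<^sup>2) \<le> (1 + 3 * \<tau>\<^sup>2) / 2 * (real n)\<^sup>2"
      using \<tau> \<tau>_bounds \<open>n > 0\<close> gt x(2) by (intro extremal_inequality) (simp_all add: UNIV_colour)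
    \<comment> \<open>The left side is \<open>n\<^sup>2\<close> plus the bound just obtained, so
      this contradicts \<open>tot(1)\<close>.\<close>
    moreover have "3 * (1 + \<tau>\<^sup>2) / 2 * (real n)\<^sup>2 < total {} V V"
      using large[of C1] large[of C2] large[of C3] by (simp add: total UNIV_colour field_simps)
    ultimately show False using tot(1) by (simp add: UNIV_colour field_simps)
  qed
qed

end
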